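(* Let $X$ be a geodesic metric space admitting a navigable, undirected path system $\mathcal P$. Then $X$ has the Morse local-to-global property.
   Context: A $(\lambda,\kappa)$-quasi-geodesic ($\lambda\ge1,\kappa\ge0$; $(\lambda,\kappa)$ is then called a quasi-geodesic pair) is a map $\gamma:I\to X$, $I\subseteq\mathbb R$ an interval, with $\frac1\lambda|t_1-t_2|-\kappa\le d(\gamma(t_1),\gamma(t_2))\le\lambda|t_1-t_2|+\kappa$. Convention: all quasi-geodesics are improved, i.e. continuous and such that the length of $\gamma|_{[t,t']}$ is at most $k_1d(\gamma(t),\gamma(t'))+k_2$, where $\kappa'=2(\lambda+\kappa)$, $k_1=\lambda(\lambda+\kappa)$, $k_2=(\lambda\kappa'+3)(\lambda+\kappa)$. For $p:[a,b]\to X$: $p^-=p(a)$, $p^+=p(b)$, $\|p\|$ is the length, $p^{-1}$ the reversed path. A path system $\mathcal P$ on $X$ is a set of quasi-geodesic segments, all $(\lambda_0,\kappa_0)$-quasi-geodesics for a common pair, containing all trivial paths, closed under passing to subsegments, and containing for all $x,y\in X$ a path from $x$ to $y$. It is undirected if closed under $h\mapsto h^{-1}$. An $(n,\mathcal P)$-polygonal line is a concatenation of at most $n$ paths of $\mathcal P$. $\mathcal P$ is navigable if there are $C\ge1$ and an integer $k\ge1$ such that for every $R\ge C$, $m\in X$, $n$, and $(n,\mathcal P)$-polygonal line $\alpha$ with $d(\alpha,m)\ge R$ and $d(\alpha^\pm,m)\le2R$, there is a $(kn,\mathcal P)$-polygonal line $p$ with the same endpoints as $\alpha$, $\|p\|\le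 CnR$, avoiding the closed ball $B(m,R/C)$. A Morse gauge is a function $M:\mathbb R_{\ge1}\times\mathbb R_{\ge0}\to\mathbb R_{\ge0}$, non-decreasing in each variable and continuous in the second. A quasi-geodesic $\gamma$ is $M$-Morse if every $(Q,q)$-quasi-geodesic with endpoints $\gamma(s),\gamma(t)$ lies in the $M(Q,q)$-neighbourhood of $\gamma|_{[s,t]}$. A path satisfies a property $L$-locally if its restriction to every subinterval of length at most $L$ satisfies it. $X$ has the Morse local-to-global property if for every quasi-geodesic pair $(\lambda,\kappa)$ and Morse gauge $M$ there exist $L$, a quasi-geodesic pair $(\lambda',\kappa')$ and a Morse gauge $M'$ such that every path that is $L$-locally an $M$-Morse $(\lambda,\kappa)$-quasi-geodesic is an $M'$-Morse $(\lambda',\kappa')$-quasi-geodesic. *)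

theory Defs
  imports "HOL-Analysis.Analysis"
begin

definition geodesic_space :: "'a::metric_space itself \<Rightarrow> bool" where
  "geodesic_space (_ :: 'a itself) \<longleftrightarrow>
     (\<forall>x y :: 'a. \<exists>\<gamma> :: real \<Rightarrow> 'a. \<gamma> 0 = x \<and> \<gamma> (dist x y) = y \<and>
        (\<forall>s\<in>{0..dist x y}. \<forall>t\<in>{0..dist x y}. dist (\<gamma> s) (\<gamma> t) = \<bar>s - t\<bar>))"

text \<open>A map from an interval \<open>I\<close> to the space is given by a function on all of \<open>real\<close> together
  with \<open>I\<close>; only the values on \<open>I\<close> are used.\<close>

definition curve_length :: "(real \<Rightarrow> 'a::metric_space) \<Rightarrow> real \<Rightarrow> real \<Rightarrow> ennreal" where
  "curve_length \<gamma> a b =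
     (SUP (n, t) \<in> {(n :: nat, t :: nat \<Rightarrow> real). mono_on {..n} t \<and> t ` {..n} \<subseteq> {a..b}}.
        \<Sum>i<n. ennreal (dist (\<gamma> (t i)) (\<gamma> (t (Suc i)))))"

definition quasi_geodesic_pair :: "real \<Rightarrow> real \<Rightarrow> bool" where
  "quasi_geodesic_pair lam \<kappa> \<longleftrightarrow> lam \<ge> 1 \<and> \<kappa> \<ge> 0"

definition improved :: "real \<Rightarrow> real \<Rightarrow> (real \<Rightarrow> 'a::metric_space) \<Rightarrow> real set \<Rightarrow> bool" where
  "improved lam \<kappa> \<gamma> I \<longleftrightarrow>
     continuous_on I \<gamma> \<and>
     (let \<kappa>' = 2 * (lam + \<kappa>); k1 = lam * (lam + \<kappa>); k2 = (lam * \<kappa>' + 3) * (lam + \<kappa>)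
      in \<forall>s\<in>I. \<forall>t\<in>I. s \<le> t \<longrightarrow>
           curve_length \<gamma> s t \<le> ennreal (k1 * dist (\<gamma> s) (\<gamma> t) + k2))"

text \<open>By convention all quasi-geodesics are improved.\<close>

definition quasi_geodesic :: "real \<Rightarrow> real \<Rightarrow> (real \<Rightarrow> 'a::metric_space) \<Rightarrow> real set \<Rightarrow> bool" where
  "quasi_geodesic lam \<kappa> \<gamma> I \<longleftrightarrow>
     quasi_geodesic_pair lam \<kappa> \<and> is_interval I \<and>
     (\<forall>s\<in>I. \<forall>t\<in>I. 1 / lam * \<bar>s - t\<bar> - \<kappa> \<le> dist (\<gamma> s) (\<gamma> t) \<and>
                   dist (\<gamma> s) (\<gamma> t) \<le> lam * \<bar>s - t\<bar> + \<kappa>) \<and>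
     improved lam \<kappa> \<gamma> I"

text \<open>A segment is a map \<open>[lo, hi] \<rightarrow> X\<close>. So that equality of segments is equality of maps,
  the underlying function is \<open>undefined\<close> outside \<open>[lo, hi]\<close>.\<close>

datatype 'a segment = Segment (lo: real) (hi: real) (fn: "real \<Rightarrow> 'a")

definition is_segment :: "'a segment \<Rightarrow> bool" where
  "is_segment p \<longleftrightarrow> lo p \<le> hi p \<and> fn p \<in> extensional {lo p..hi p}"

definition seg :: "real \<Rightarrow> real \<Rightarrow> (real \<Rightarrow> 'a) \<Rightarrow> 'a segment" where
  "seg a b f = Segment a b (restrict f {a..b})"

definition seg_start :: "'a segment \<Rightarrow> 'a" where
  "seg_start p = fn p (lo p)"

definition seg_end :: "'a segment \<Rightarrow> 'a" where
  "seg_end p = fn p (hi p)"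

definition seg_image :: "'a segment \<Rightarrow> 'a set" where
  "seg_image p = fn p ` {lo p..hi p}"

definition seg_length :: "'a::metric_space segment \<Rightarrow> ennreal" where
  "seg_length p = curve_length (fn p) (lo p) (hi p)"

definition seg_reverse :: "'a segment \<Rightarrow> 'a segment" where
  "seg_reverse p = seg (lo p) (hi p) (\<lambda>t. fn p (lo p + hi p - t))"

text \<open>In a concatenation the domain of the second segment is translated so as to begin where the
  domain of the first one ends.\<close>

definition seg_concat :: "'a segment \<Rightarrow> 'a segment \<Rightarrow> 'a segment" where
  "seg_concat p q = seg (lo p) (hi p + (hi q - lo q))
     (\<lambda>t. if t \<le> hi p then fn p t else fn q (lo q + (t - hi p)))"

definition path_system :: "'a::metric_space segment set \<Rightarrow> bool" where
  "path_system P \<longleftrightarrow>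
     (\<forall>p\<in>P. is_segment p) \<and>
     (\<exists>lam\<^sub>0 \<kappa>\<^sub>0. quasi_geodesic_pair lam\<^sub>0 \<kappa>\<^sub>0 \<and>
        (\<forall>p\<in>P. quasi_geodesic lam\<^sub>0 \<kappa>\<^sub>0 (fn p) {lo p..hi p})) \<and>
     (\<forall>a x. seg a a (\<lambda>_. x) \<in> P) \<and>
     (\<forall>p\<in>P. \<forall>c d. lo p \<le> c \<and> c \<le> d \<and> d \<le> hi p \<longrightarrow> seg c d (fn p) \<in> P) \<and>
     (\<forall>x y. \<exists>p\<in>P. seg_start p = x \<and> seg_end p = y)"

definition undirected :: "'a segment set \<Rightarrow> bool" where
  "undirected P \<longleftrightarrow> (\<forall>p\<in>P. seg_reverse p \<in> P)"

text \<open>\<open>polygonal_line P n \<alpha>\<close>: \<open>\<alpha>\<close> is a concatenation of at least one and at most \<open>n\<close> segments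
  of \<open>P\<close>.\<close>

inductive polygonal_line :: "'a segment set \<Rightarrow> nat \<Rightarrow> 'a segment \<Rightarrow> bool" for P where
  single: "p \<in> P \<Longrightarrow> n \<ge> 1 \<Longrightarrow> polygonal_line P n p"
| snoc: "polygonal_line P n \<alpha> \<Longrightarrow> p \<in> P \<Longrightarrow> seg_end \<alpha> = seg_start p \<Longrightarrow>
    polygonal_line P (Suc n) (seg_concat \<alpha> p)"

definition navigable :: "'a::metric_space segment set \<Rightarrow> bool" where
  "navigable P \<longleftrightarrow>
     (\<exists>(C::real) (k::nat). C \<ge> 1 \<and> k \<ge> 1 \<and>
        (\<forall>R m n \<alpha>. R \<ge> C \<and> polygonal_line P n \<alpha> \<and> infdist m (seg_image \<alpha>) \<ge> R \<and>
             dist (seg_start \<alpha>) m \<le> 2 * R \<and> dist (seg_end \<alpha>) m \<le> 2 * R \<longrightarrow>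
           (\<exists>p. polygonal_line P (k * n) p \<and>
                seg_start p = seg_start \<alpha> \<and> seg_end p = seg_end \<alpha> \<and>
                seg_length p \<le> ennreal (C * real n * R) \<and>
                seg_image p \<inter> cball m (R / C) = {})))"

definition morse_gauge :: "(real \<Rightarrow> real \<Rightarrow> real) \<Rightarrow> bool" where
  "morse_gauge M \<longleftrightarrow>
     (\<forall>Q\<ge>1. \<forall>q\<ge>0. M Q q \<ge> 0) \<and>
     (\<forall>q\<ge>0. mono_on {1..} (\<lambda>Q. M Q q)) \<and>
     (\<forall>Q\<ge>1. mono_on {0..} (M Q) \<and> continuous_on {0..} (M Q))"

text \<open>The neighbourhoods are closed: a gauge may take the value 0, and the open neighbourhood of
  radius 0 is empty.\<close>

definition morse :: "(real \<Rightarrow> real \<Rightarrow> real) \<Rightarrow> (real \<Rightarrow> 'a::metric_space) \<Rightarrow> real set \<Rightarrow> bool" where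
  "morse M \<gamma> I \<longleftrightarrow>
     (\<forall>Q q s t \<sigma> c d.
        s \<in> I \<and> t \<in> I \<and> s \<le> t \<and> c \<le> d \<and> quasi_geodesic Q q \<sigma> {c..d} \<and>
        \<sigma> c = \<gamma> s \<and> \<sigma> d = \<gamma> t \<longrightarrow>
        (\<forall>u\<in>{c..d}. infdist (\<sigma> u) (\<gamma> ` {s..t}) \<le> M Q q))"

definition morse_quasi_geodesic ::
  "(real \<Rightarrow> real \<Rightarrow> real) \<Rightarrow> real \<Rightarrow> real \<Rightarrow> (real \<Rightarrow> 'a::metric_space) \<Rightarrow> real set \<Rightarrow> bool" where
  "morse_quasi_geodesic M lam \<kappa> \<gamma> I \<longleftrightarrow> quasi_geodesic lam \<kappa> \<gamma> I \<and> morse M \<gamma> I"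

definition locally_at_scale ::
  "real \<Rightarrow> ((real \<Rightarrow> 'a) \<Rightarrow> real set \<Rightarrow> bool) \<Rightarrow> (real \<Rightarrow> 'a) \<Rightarrow> real set \<Rightarrow> bool" where
  "locally_at_scale L A \<gamma> I \<longleftrightarrow>
     (\<forall>J. J \<subseteq> I \<and> is_interval J \<and> (\<forall>s\<in>J. \<forall>t\<in>J. \<bar>s - t\<bar> \<le> L) \<longrightarrow> A \<gamma> J)"

definition morse_local_to_global :: "'a::metric_space itself \<Rightarrow> bool" where
  "morse_local_to_global (_ :: 'a itself) \<longleftrightarrow>
     (\<forall>lam \<kappa> M. quasi_geodesic_pair lam \<kappa> \<and> morse_gauge M \<longrightarrow>
        (\<exists>L lam' \<kappa>' M'. L > 0 \<and> quasi_geodesic_pair lam' \<kappa>' \<and> morse_gauge M' \<and>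
           (\<forall>(\<gamma> :: real \<Rightarrow> 'a) I. is_interval I \<and> continuous_on I \<gamma> \<and>
                locally_at_scale L (morse_quasi_geodesic M lam \<kappa>) \<gamma> I \<longrightarrow>
              morse_quasi_geodesic M' lam' \<kappa>' \<gamma> I)))"

end

theory Submission
  imports Defs
begin

text \<open>
  Let \<open>\<gamma>\<close> be locally Morse. Suppose a bounded number of segments of \<open>P\<close> joins two points of \<open>\<gamma>\<close> on
  either side of \<open>c = \<gamma> m\<close>, at distance about \<open>2R\<close> from \<open>c\<close>, while avoiding the ball of radius \<open>R\<close>
  about \<open>c\<close>. Navigability turns it into a path of length \<open>O(R)\<close> avoiding the ball of radius \<open>R/C\<close>.
  Such a path is close to a piecewise geodesic which is a quasi-geodesic with constants independent
  of \<open>R\<close>, so for one fixed large \<open>R\<close> it contradicts the local Morse property: 11 segments cannot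
  bypass \<open>\<gamma>\<close> at scale \<open>R\<close>.

  Consequently, by induction on the length, every path of \<open>P\<close> between two points of \<open>\<gamma>\<close> comes within
  \<open>2R\<close> of every intermediate point of \<open>\<gamma>\<close>: otherwise that path, together with three short pieces on
  each side supplied by the induction hypothesis, bypasses \<open>\<gamma>\<close>. Counting well-separated points
  along the path shows that \<open>\<gamma>\<close> is a global quasi-geodesic.

  For the Morse property, send a point \<open>v\<close> to the place where a path of \<open>P\<close> from \<open>v\<close> towards \<open>\<gamma>\<close> first
  comes within \<open>R\<close> of \<open>\<gamma>\<close>. The ends of a path of \<open>P\<close> staying at distance \<open>R\<close> from \<open>\<gamma>\<close> have images at
  bounded distance along \<open>\<gamma>\<close>, by the same bypass argument. Hence a quasi-geodesic making a long
  excursion at height \<open>H\<close> above \<open>\<gamma>\<close> advances along \<open>\<gamma>\<close> by only \<open>O(1/H)\<close> times its own length, which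
  bounds the excursion once \<open>H\<close> is large compared with its constants.
\<close>

section \<open>Segments and polygonal lines\<close>

lemma seg_sel [simp]:
  "lo (seg a b f) = a" "hi (seg a b f) = b"
  "a \<le> t \<Longrightarrow> t \<le> b \<Longrightarrow> fn (seg a b f) t = f t"
  by (auto simp: seg_def)

lemma seg_image_seg: "seg_image (seg a b f) = f ` {a..b}"
  by (auto simp: seg_image_def seg_def)

lemma seg_start_in_image: "is_segment p \<Longrightarrow> seg_start p \<in> seg_image p"
  and seg_end_in_image: "is_segment p \<Longrightarrow> seg_end p \<in> seg_image p"
  by (auto simp: is_segment_def seg_start_def seg_end_def seg_image_def)

lemma is_segment_seg: "a \<le> b \<Longrightarrow> is_segment (seg a b f)"
  by (auto simp: is_segment_def seg_def)

lemma seg_reverse_facts: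
  assumes "is_segment p"
  shows "seg_start (seg_reverse p) = seg_end p" "seg_end (seg_reverse p) = seg_start p"
    "seg_image (seg_reverse p) = seg_image p"
proof -
  have *: "lo p \<le> hi p" using assms by (simp add: is_segment_def)
  show "seg_start (seg_reverse p) = seg_end p" "seg_end (seg_reverse p) = seg_start p"
    using * by (simp_all add: seg_reverse_def seg_start_def seg_end_def seg_def)
  have "{lo p..hi p} = (\<lambda>t. lo p + hi p - t) ` {lo p..hi p}"
    by (simp add: image_diff_atLeastAtMost)
  then have "fn p ` {lo p..hi p} = (\<lambda>t. fn p (lo p + hi p - t)) ` {lo p..hi p}"
    by (metis (no_types, lifting) image_cong image_image)
  then show "seg_image (seg_reverse p) = seg_image p"
    unfolding seg_reverse_def seg_image_seg by (simp add: seg_image_def)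
qed

lemma seg_concat_facts:
  assumes "is_segment p" "is_segment q" "seg_end p = seg_start q"
  shows "is_segment (seg_concat p q)" "seg_start (seg_concat p q) = seg_start p"
    "seg_end (seg_concat p q) = seg_end q"
    "seg_image (seg_concat p q) = seg_image p \<union> seg_image q"
proof -
  have *: "lo p \<le> hi p" "lo q \<le> hi q" using assms by (simp_all add: is_segment_def)
  have eq: "fn p (hi p) = fn q (lo q)" using assms by (simp add: seg_start_def seg_end_def)
  show "is_segment (seg_concat p q)" using * by (simp add: seg_concat_def is_segment_seg)
  show "seg_start (seg_concat p q) = seg_start p"
    using * by (simp add: seg_start_def seg_concat_def)
  show "seg_end (seg_concat p q) = seg_end q"
    using * eq by (auto simp: seg_end_def seg_concat_def)
  let ?f = "\<lambda>t. if t \<le> hi p then fn p t else fn q (lo q + (t - hi p))"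
  have 1: "?f ` {lo p..hi p} = fn p ` {lo p..hi p}" by (intro image_cong) auto
  have "?f ` {hi p..hi p + (hi q - lo q)} = (fn q \<circ> (\<lambda>t. t + (lo q - hi p))) ` {hi p..hi p + (hi q - lo q)}"
    using eq by (intro image_cong) (auto simp: algebra_simps)
  also have "\<dots> = fn q ` {lo q..hi q}"
    by (simp only: image_comp [symmetric] image_add_atLeastAtMost') simp
  finally have 2: "?f ` {hi p..hi p + (hi q - lo q)} = fn q ` {lo q..hi q}" .
  have "{lo p..hi p + (hi q - lo q)} = {lo p..hi p} \<union> {hi p..hi p + (hi q - lo q)}" using * by auto
  then have "?f ` {lo p..hi p + (hi q - lo q)} = fn p ` {lo p..hi p} \<union> fn q ` {lo q..hi q}"
    using 1 2 by (simp only: image_Un)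
  then show "seg_image (seg_concat p q) = seg_image p \<union> seg_image q"
    by (simp only: seg_concat_def seg_image_seg) (simp add: seg_image_def)
qed

lemma polygonal_line_mono: "polygonal_line P n \<alpha> \<Longrightarrow> n \<le> m \<Longrightarrow> polygonal_line P m \<alpha>"
proof (induction n \<alpha> arbitrary: m rule: polygonal_line.induct)
  case (single p n)
  then show ?case by (auto intro: polygonal_line.single)
next
  case (snoc n \<alpha> p)
  obtain m' where m: "m = Suc m'" "n \<le> m'" using snoc.prems by (cases m) auto
  show ?case unfolding m(1) by (intro polygonal_line.snoc snoc.IH snoc.hyps m)
qed

section \<open>Joining points by few paths of \<open>P\<close> inside a region\<close>

definition link :: "'a segment set \<Rightarrow> 'a set \<Rightarrow> 'a \<Rightarrow> 'a \<Rightarrow> bool" where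
  "link P S x y \<longleftrightarrow> (\<exists>p\<in>P. seg_start p = x \<and> seg_end p = y \<and> seg_image p \<subseteq> S)"

text \<open>Only the ends, the segment count and the region are kept, so that parametrizations of
  concatenations drop out of all later arguments.\<close>

definition conn :: "'a segment set \<Rightarrow> nat \<Rightarrow> 'a set \<Rightarrow> 'a \<Rightarrow> 'a \<Rightarrow> bool" where
  "conn P n S x y \<longleftrightarrow>
     (\<exists>\<alpha>. polygonal_line P n \<alpha> \<and> seg_start \<alpha> = x \<and> seg_end \<alpha> = y \<and> seg_image \<alpha> \<subseteq> S)"

lemma link_subset: "link P S x y \<Longrightarrow> S \<subseteq> T \<Longrightarrow> link P T x y"
  by (auto simp: link_def)

lemma link_conn: "link P S x y \<Longrightarrow> conn P 1 S x y"
  unfolding link_def conn_def by (meson polygonal_line.single order_refl)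

lemma conn_mono: "conn P n S x y \<Longrightarrow> n \<le> m \<Longrightarrow> conn P m S x y"
  by (auto simp: conn_def intro: polygonal_line_mono)

locale path_family =
  fixes P :: "'a::metric_space segment set" and l0 k0 :: real
  assumes l0: "l0 \<ge> 1" and k0: "k0 \<ge> 0"
    and segment: "p \<in> P \<Longrightarrow> is_segment p"
    and quasi_geo: "p \<in> P \<Longrightarrow> quasi_geodesic l0 k0 (fn p) {lo p..hi p}"
    and subpath: "p \<in> P \<Longrightarrow> lo p \<le> c \<Longrightarrow> c \<le> d \<Longrightarrow> d \<le> hi p \<Longrightarrow> seg c d (fn p) \<in> P"
    and ex_path: "\<exists>p\<in>P. seg_start p = x \<and> seg_end p = y"
    and reverse: "p \<in> P \<Longrightarrow> seg_reverse p \<in> P"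
begin

lemma lo_le_hi: "p \<in> P \<Longrightarrow> lo p \<le> hi p"
  using segment by (auto simp: is_segment_def)

lemma path_cont: "p \<in> P \<Longrightarrow> continuous_on {lo p..hi p} (fn p)"
  using quasi_geo by (auto simp: quasi_geodesic_def improved_def)

lemma path_upper: "p \<in> P \<Longrightarrow> u \<in> {lo p..hi p} \<Longrightarrow> v \<in> {lo p..hi p} \<Longrightarrow>
    dist (fn p u) (fn p v) \<le> l0 * \<bar>u - v\<bar> + k0"
  using quasi_geo by (auto simp: quasi_geodesic_def)

lemma path_lower: "p \<in> P \<Longrightarrow> u \<in> {lo p..hi p} \<Longrightarrow> v \<in> {lo p..hi p} \<Longrightarrow>
    \<bar>u - v\<bar> \<le> l0 * (dist (fn p u) (fn p v) + k0)"
  using quasi_geo[of p] l0 by (fastforce simp: quasi_geodesic_def field_simps)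

lemma polygonal_line_is_segment: "polygonal_line P n \<alpha> \<Longrightarrow> is_segment \<alpha>"
  by (induction rule: polygonal_line.induct) (auto simp: segment seg_concat_facts)

lemma link_sym: "link P S x y \<Longrightarrow> link P S y x"
  unfolding link_def
proof (elim bexE conjE)
  fix p assume "p \<in> P" "seg_start p = x" "seg_end p = y" "seg_image p \<subseteq> S"
  then show "\<exists>p\<in>P. seg_start p = y \<and> seg_end p = x \<and> seg_image p \<subseteq> S"
    using seg_reverse_facts[OF segment] reverse by (intro bexI[of _ "seg_reverse p"]) auto
qed

lemma conn_link:
  assumes "conn P n S x y" "link P S y z" shows "conn P (Suc n) S x z"
proof -
  obtain \<alpha> where \<alpha>: "polygonal_line P n \<alpha>" "seg_start \<alpha> = x" "seg_end \<alpha> = y" "seg_image \<alpha> \<subseteq> S"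
    using assms(1) by (auto simp: conn_def)
  obtain p where p: "p \<in> P" "seg_start p = y" "seg_end p = z" "seg_image p \<subseteq> S"
    using assms(2) by (auto simp: link_def)
  have e: "seg_end \<alpha> = seg_start p" using \<alpha> p by simp
  note f = seg_concat_facts[OF polygonal_line_is_segment[OF \<alpha>(1)] segment[OF p(1)] e]
  show ?thesis
    unfolding conn_def using polygonal_line.snoc[OF \<alpha>(1) p(1) e] f \<alpha> p by blast
qed

text \<open>Since \<open>polygonal_line\<close> grows only at its end, two lines are joined by
  appending the segments of the second one by one. This is the induction behind
  \<open>conn_trans\<close>.\<close>

lemma conn_polygonal_line:
  assumes "polygonal_line P m \<alpha>" "seg_image \<alpha> \<subseteq> S" "conn P n S x (seg_start \<alpha>)"
  shows "conn P (n + m) S x (seg_end \<alpha>)"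
  using assms
proof (induction rule: polygonal_line.induct)
  case (single p m)
  have "conn P (Suc n) S x (seg_end p)" using single by (intro conn_link) (auto simp: link_def)
  then show ?case using single by (auto intro: conn_mono)
next
  case (snoc m \<alpha> p)
  note f = seg_concat_facts[OF polygonal_line_is_segment[OF snoc.hyps(1)] segment[OF snoc.hyps(2)] snoc.hyps(3)]
  have "conn P (n + m) S x (seg_end \<alpha>)" using snoc by (auto simp: f)
  then have "conn P (Suc (n + m)) S x (seg_end p)"
    using snoc f by (intro conn_link) (auto simp: link_def)
  then show ?case by (simp add: f)
qed

lemma conn_trans: "conn P n S x y \<Longrightarrow> conn P m S y z \<Longrightarrow> conn P (n + m) S x z"
  unfolding conn_def[of P m S y z] by (elim exE conjE) (use conn_polygonal_line in blast)

text \<open>The last segment is reversed and placed first, and induction handles the rest. As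
  \<open>conn\<close> forgets parametrizations, no reversed concatenation has to be
  computed.\<close>

lemma conn_sym:
  assumes "conn P n S x y" shows "conn P n S y x"
proof -
  have "seg_image \<alpha> \<subseteq> S \<Longrightarrow> conn P n S (seg_end \<alpha>) (seg_start \<alpha>)" if "polygonal_line P n \<alpha>" for \<alpha>
    using that
  proof (induction rule: polygonal_line.induct)
    case (single p n)
    then have "link P S (seg_start p) (seg_end p)" by (auto simp: link_def)
    then have "conn P 1 S (seg_end p) (seg_start p)" by (rule link_conn[OF link_sym])
    then show ?case using single by (auto intro: conn_mono)
  next
    case (snoc m \<alpha> p)
    note f = seg_concat_facts[OF polygonal_line_is_segment[OF snoc.hyps(1)] segment[OF snoc.hyps(2)] snoc.hyps(3)]
    have "link P S (seg_end \<alpha>) (seg_end p)"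
      using snoc f by (auto simp: link_def)
    then have "conn P 1 S (seg_end p) (seg_end \<alpha>)" by (rule link_conn[OF link_sym])
    moreover have "conn P m S (seg_end \<alpha>) (seg_start \<alpha>)" using snoc by (auto simp: f)
    ultimately have "conn P (1 + m) S (seg_end p) (seg_start \<alpha>)" by (rule conn_trans)
    then show ?case by (simp add: f)
  qed
  then show ?thesis using assms unfolding conn_def by blast
qed

text \<open>How far a path of \<open>P\<close> can stray from either end when its ends are
  \<open>d\<close> apart: the lower quasi-geodesic inequality bounds its parameter length by
  \<open>l0 * (d + k0)\<close>, and the upper one turns this into a distance.\<close>

definition spread :: "real \<Rightarrow> real" where
  "spread d = l0 * (l0 * (d + k0)) + k0"

lemma spread_mono: "a \<le> b \<Longrightarrow> spread a \<le> spread b"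
  using l0 by (auto simp: spread_def intro!: mult_left_mono)

lemma spread_ge: assumes "0 \<le> d" shows "d \<le> spread d"
proof -
  have "1 * (1 * (d + k0)) \<le> l0 * (l0 * (d + k0))"
    using l0 k0 assms by (intro mult_mono) auto
  then show ?thesis using k0 by (simp add: spread_def)
qed

lemma path_spread:
  assumes "p \<in> P" "lo p \<le> u" "u \<le> v" "v \<le> w" "w \<le> hi p"
  shows "dist (fn p u) (fn p v) \<le> spread (dist (fn p u) (fn p w))"
    and "dist (fn p w) (fn p v) \<le> spread (dist (fn p u) (fn p w))"
proof -
  have uw: "w - u \<le> l0 * (dist (fn p u) (fn p w) + k0)" using path_lower[of p u w] assms by auto
  have "l0 * (v - u) \<le> l0 * (l0 * (dist (fn p u) (fn p w) + k0))"
    using uw assms l0 by (intro mult_left_mono) auto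
  then show "dist (fn p u) (fn p v) \<le> spread (dist (fn p u) (fn p w))"
    using path_upper[of p u v] assms by (auto simp: spread_def)
  have "l0 * (w - v) \<le> l0 * (l0 * (dist (fn p u) (fn p w) + k0))"
    using uw assms l0 by (intro mult_left_mono) auto
  then show "dist (fn p w) (fn p v) \<le> spread (dist (fn p u) (fn p w))"
    using path_upper[of p w v] assms by (auto simp: spread_def)
qed

lemma link_spread: "dist x y \<le> d \<Longrightarrow> link P (cball x (spread d)) x y"
proof -
  assume d: "dist x y \<le> d"
  obtain p where p: "p \<in> P" "seg_start p = x" "seg_end p = y" using ex_path by blast
  have "seg_image p \<subseteq> cball x (spread d)"
    using path_spread(1)[OF p(1) order_refl, of _ "hi p"] p spread_mono[OF d]
    by (fastforce simp: seg_image_def seg_start_def seg_end_def)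
  then show ?thesis using p by (auto simp: link_def)
qed

lemma link_subpath:
  assumes "p \<in> P" "lo p \<le> u" "u \<le> v" "v \<le> hi p" "fn p ` {u..v} \<subseteq> S"
  shows "link P S (fn p u) (fn p v)"
  unfolding link_def
  using assms by (intro bexI[OF _ subpath[of p u v]]) (auto simp: seg_start_def seg_end_def seg_image_seg)

end

section \<open>Piecewise geodesic quasi-geodesics\<close>

lemma dist_le_curve_length:
  assumes "u \<in> {a..b}" "v \<in> {a..b}"
  shows "ennreal (dist (\<gamma> u) (\<gamma> v)) \<le> curve_length \<gamma> a b"
proof -
  have *: "ennreal (dist (\<gamma> u) (\<gamma> v)) \<le> curve_length \<gamma> a b" if "u \<in> {a..b}" "v \<in> {a..b}" "u \<le> v" for u v
  proof -
    let ?t = "\<lambda>i::nat. if i = 0 then u else v"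
    have "(1, ?t) \<in> {(n, t). mono_on {..n} t \<and> t ` {..n} \<subseteq> {a..b}}"
      using that by (auto simp: mono_on_def)
    then have "(case (1, ?t) of (n, t) \<Rightarrow> \<Sum>i<n. ennreal (dist (\<gamma> (t i)) (\<gamma> (t (Suc i))))) \<le> curve_length \<gamma> a b"
      unfolding curve_length_def by (rule SUP_upper)
    then show ?thesis by simp
  qed
  show ?thesis
    using *[of u v] *[of v u] assms by (cases "u \<le> v") (auto simp: dist_commute)
qed

lemma curve_length_le:
  assumes mono: "\<And>s t. a \<le> s \<Longrightarrow> s \<le> t \<Longrightarrow> t \<le> b \<Longrightarrow> dist (\<gamma> s) (\<gamma> t) \<le> t - s" and "a \<le> b"
  shows "curve_length \<gamma> a b \<le> ennreal (b - a)"
  unfolding curve_length_def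
proof (rule SUP_least, clarify)
  fix n :: nat and t :: "nat \<Rightarrow> real"
  assume t: "mono_on {..n} t" "t ` {..n} \<subseteq> {a..b}"
  have step: "dist (\<gamma> (t i)) (\<gamma> (t (Suc i))) \<le> t (Suc i) - t i" if "i < n" for i
    using t that by (intro mono) (auto simp: mono_on_def image_subset_iff)
  have "(\<Sum>i<n. ennreal (dist (\<gamma> (t i)) (\<gamma> (t (Suc i))))) = ennreal (\<Sum>i<n. dist (\<gamma> (t i)) (\<gamma> (t (Suc i))))"
    by (simp add: sum_ennreal)
  also have "\<dots> \<le> ennreal (\<Sum>i<n. t (Suc i) - t i)"
    using step by (intro ennreal_leI sum_mono) auto
  also have "(\<Sum>i<n. t (Suc i) - t i) = t n - t 0" by (rule sum_lessThan_telescope)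
  also have "ennreal (t n - t 0) \<le> ennreal (b - a)"
    using t(2) by (intro ennreal_leI) (auto simp: image_subset_iff intro!: diff_mono)
  finally show "(\<Sum>i<n. ennreal (dist (\<gamma> (t i)) (\<gamma> (t (Suc i))))) \<le> ennreal (b - a)" .
qed

text \<open>Chord-arc paths. The upper constant is 1 rather than \<open>Q\<close>, so that parameter
  length bounds curve length. For \<open>Q \<ge> 1\<close> this makes the path improved, hence a
  \<open>(Q, 0)\<close>-quasi-geodesic.\<close>

definition lip_geo :: "real \<Rightarrow> (real \<Rightarrow> 'a::metric_space) \<Rightarrow> real \<Rightarrow> bool" where
  "lip_geo Q \<beta> l \<longleftrightarrow> 0 \<le> l \<and>
     (\<forall>s t. 0 \<le> s \<and> s \<le> t \<and> t \<le> l \<longrightarrow>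
        dist (\<beta> s) (\<beta> t) \<le> t - s \<and> t - s \<le> Q * dist (\<beta> s) (\<beta> t))"

lemma lip_geo_abs:
  assumes "lip_geo Q \<beta> l" "s \<in> {0..l}" "t \<in> {0..l}"
  shows "dist (\<beta> s) (\<beta> t) \<le> \<bar>s - t\<bar>" "\<bar>s - t\<bar> \<le> Q * dist (\<beta> s) (\<beta> t)"
proof -
  have "dist (\<beta> s) (\<beta> t) \<le> \<bar>s - t\<bar> \<and> \<bar>s - t\<bar> \<le> Q * dist (\<beta> s) (\<beta> t)"
  proof (cases "s \<le> t")
    case True
    then show ?thesis using assms by (auto simp: lip_geo_def)
  next
    case False
    then have "dist (\<beta> t) (\<beta> s) \<le> s - t \<and> s - t \<le> Q * dist (\<beta> t) (\<beta> s)"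
      using assms by (auto simp: lip_geo_def)
    then show ?thesis using False by (simp add: dist_commute)
  qed
  then show "dist (\<beta> s) (\<beta> t) \<le> \<bar>s - t\<bar>" "\<bar>s - t\<bar> \<le> Q * dist (\<beta> s) (\<beta> t)" by auto
qed

lemma lip_geo_cont:
  assumes "lip_geo Q \<beta> l" shows "continuous_on {0..l} \<beta>"
proof -
  have "1-lipschitz_on {0..l} \<beta>"
  proof (rule lipschitz_onI)
    fix x y assume "x \<in> {0..l}" "y \<in> {0..l}"
    then show "dist (\<beta> x) (\<beta> y) \<le> 1 * dist x y"
      using lip_geo_abs(1)[OF assms] by (simp add: dist_real_def)
  qed simp
  then show ?thesis by (rule lipschitz_on_continuous_on)
qed

lemma lip_geo_quasi_geodesic:
  assumes "lip_geo Q \<beta> l" "Q \<ge> 1"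
  shows "quasi_geodesic Q 0 \<beta> {0..l}"
proof -
  have b: "dist (\<beta> s) (\<beta> t) \<le> \<bar>s - t\<bar> \<and> \<bar>s - t\<bar> \<le> Q * dist (\<beta> s) (\<beta> t)"
    if "s \<in> {0..l}" "t \<in> {0..l}" for s t
    using lip_geo_abs[OF assms(1) that] by simp
  have ql: "1 / Q * \<bar>s - t\<bar> - 0 \<le> dist (\<beta> s) (\<beta> t)" "dist (\<beta> s) (\<beta> t) \<le> Q * \<bar>s - t\<bar> + 0"
    if "s \<in> {0..l}" "t \<in> {0..l}" for s t
  proof -
    show "1 / Q * \<bar>s - t\<bar> - 0 \<le> dist (\<beta> s) (\<beta> t)" using b[OF that] assms(2) by (simp add: field_simps)
    have "1 * \<bar>s - t\<bar> \<le> Q * \<bar>s - t\<bar>" using assms(2) by (intro mult_right_mono) auto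
    then show "dist (\<beta> s) (\<beta> t) \<le> Q * \<bar>s - t\<bar> + 0" using b[OF that] by simp
  qed
  have len: "curve_length \<beta> s t \<le> ennreal (Q * (Q + 0) * dist (\<beta> s) (\<beta> t) + (Q * (2 * (Q + 0)) + 3) * (Q + 0))"
    if "s \<in> {0..l}" "t \<in> {0..l}" "s \<le> t" for s t
  proof -
    have "curve_length \<beta> s t \<le> ennreal (t - s)"
      using assms(1) that by (intro curve_length_le) (auto simp: lip_geo_def)
    also have "t - s \<le> Q * Q * dist (\<beta> s) (\<beta> t)"
    proof -
      have "Q * dist (\<beta> s) (\<beta> t) \<le> (Q * Q) * dist (\<beta> s) (\<beta> t)"
        using assms(2) by (intro mult_right_mono) auto
      then show ?thesis using b[of s t] that by simp
    qed
    also have "\<dots> \<le> Q * (Q + 0) * dist (\<beta> s) (\<beta> t) + (Q * (2 * (Q + 0)) + 3) * (Q + 0)"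
      using assms(2) by (simp add: mult_nonneg_nonneg)
    finally show ?thesis by (simp add: ennreal_leI)
  qed
  show ?thesis
    unfolding quasi_geodesic_def quasi_geodesic_pair_def improved_def Let_def
    using assms(2) lip_geo_cont[OF assms(1)] ql len by auto
qed

lemma geodesic_spaceE:
  assumes "geodesic_space TYPE('a::metric_space)"
  obtains g where "g 0 = (x::'a)" "g (dist x y) = y"
    "\<And>s t. 0 \<le> s \<Longrightarrow> s \<le> dist x y \<Longrightarrow> 0 \<le> t \<Longrightarrow> t \<le> dist x y \<Longrightarrow> dist (g s) (g t) = \<bar>s - t\<bar>"
  using assms unfolding geodesic_space_def by (metis atLeastAtMost_iff)

text \<open>Cutting \<open>\<beta>\<close> at the point nearest to \<open>z\<close> and continuing along a geodesic to \<open>z\<close>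
  at most doubles the multiplicative constant.\<close>

lemma lip_geo_extend:
  fixes z :: "'a::metric_space"
  assumes gs: "geodesic_space TYPE('a)" and \<beta>: "lip_geo Q \<beta> l" and Q: "Q \<ge> 1"
  obtains \<beta>' l' where "lip_geo (2 * Q + 1) \<beta>' l'" "\<beta>' 0 = \<beta> 0" "\<beta>' l' = z"
    "\<And>u. 0 \<le> u \<Longrightarrow> u \<le> l' \<Longrightarrow> \<beta>' u \<in> \<beta> ` {0..l} \<or> dist (\<beta>' u) z \<le> dist (\<beta> l) z"
proof -
  have l: "0 \<le> l" using \<beta> by (auto simp: lip_geo_def)
  have "continuous_on {0..l} (\<lambda>u. dist (\<beta> u) z)"
    by (intro continuous_intros lip_geo_cont[OF \<beta>])
  then obtain w where w: "w \<in> {0..l}" and wmin: "\<And>u. u \<in> {0..l} \<Longrightarrow> dist (\<beta> w) z \<le> dist (\<beta> u) z"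
    using continuous_attains_inf[of "{0..l}" "\<lambda>u. dist (\<beta> u) z"] l by auto
  obtain g where g: "g 0 = \<beta> w" "g (dist (\<beta> w) z) = z"
    and gd: "\<And>s t. 0 \<le> s \<Longrightarrow> s \<le> dist (\<beta> w) z \<Longrightarrow> 0 \<le> t \<Longrightarrow> t \<le> dist (\<beta> w) z \<Longrightarrow> dist (g s) (g t) = \<bar>s - t\<bar>"
    using geodesic_spaceE[OF gs] by metis
  define D where "D = dist (\<beta> w) z"
  define \<beta>' where "\<beta>' u = (if u \<le> w then \<beta> u else g (u - w))" for u
  define l' where "l' = w + D"
  have D: "0 \<le> D" by (simp add: D_def)
  \<comment> \<open>As \<open>\<beta> w\<close> is nearest to \<open>z\<close>, all of
    \<open>\<beta>\<close> is at distance at least \<open>D\<close> from \<open>z\<close>, whereas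
    \<open>g (u - w)\<close> is at distance \<open>D - (u - w)\<close>.\<close>
  have far: "u - w \<le> dist (\<beta> s) (g (u - w))" if "s \<in> {0..l}" "w \<le> u" "u \<le> l'" for s u
  proof -
    have "D \<le> dist (\<beta> s) (g (u - w)) + dist (g (u - w)) z"
      using wmin[OF that(1)] dist_triangle[of "\<beta> s" z "g (u - w)"] by (simp add: D_def)
    moreover have "dist (g (u - w)) z = D - (u - w)"
      using gd[of "u - w" D] that g(2) by (simp add: D_def l'_def)
    ultimately show ?thesis by simp
  qed
  have main: "dist (\<beta>' s) (\<beta>' t) \<le> t - s \<and> t - s \<le> (2 * Q + 1) * dist (\<beta>' s) (\<beta>' t)"
    if st: "0 \<le> s" "s \<le> t" "t \<le> l'" for s t
  proof -
    consider "t \<le> w" | "s \<le> w" "w < t" | "w < s" using st by linarith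
    then show ?thesis
    proof cases
      case 1
      then have b: "dist (\<beta> s) (\<beta> t) \<le> t - s" "t - s \<le> Q * dist (\<beta> s) (\<beta> t)"
        using \<beta> st w by (auto simp: lip_geo_def)
      moreover have "Q * dist (\<beta> s) (\<beta> t) \<le> (2 * Q + 1) * dist (\<beta> s) (\<beta> t)"
        using Q by (intro mult_right_mono) auto
      ultimately show ?thesis using 1 st by (simp add: \<beta>'_def)
    next
      case 2
      have b: "dist (\<beta> s) (\<beta> w) \<le> w - s" "w - s \<le> Q * dist (\<beta> s) (\<beta> w)"
        using \<beta> st w 2 by (auto simp: lip_geo_def)
      have gw: "dist (\<beta> w) (g (t - w)) = t - w"
        using gd[of 0 "t - w"] g(1) st 2 by (simp add: l'_def D_def)
      have f: "t - w \<le> dist (\<beta> s) (g (t - w))" using far[of s t] st 2 w by auto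
      have "dist (\<beta> s) (\<beta> w) \<le> dist (\<beta> s) (g (t - w)) + dist (\<beta> w) (g (t - w))"
        by (metis dist_triangle2)
      \<comment> \<open>The chord dominates the geodesic leg by \<open>f\<close>, hence half of the
        chord of the leg in \<open>\<beta>\<close>. The two legs contribute \<open>1\<close> and
        \<open>2 * Q\<close> to the new constant.\<close>
      then have "dist (\<beta> s) (\<beta> w) \<le> 2 * dist (\<beta> s) (g (t - w))" using gw f by simp
      then have "Q * dist (\<beta> s) (\<beta> w) \<le> Q * (2 * dist (\<beta> s) (g (t - w)))"
        using Q by (intro mult_left_mono) auto
      then have up: "t - s \<le> (2 * Q + 1) * dist (\<beta> s) (g (t - w))"
        using b f by (simp add: algebra_simps)
      have "dist (\<beta> s) (g (t - w)) \<le> t - s"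
        using dist_triangle[of "\<beta> s" "g (t - w)" "\<beta> w"] b gw by simp
      then show ?thesis using up 2 by (simp add: \<beta>'_def)
    next
      case 3
      have "dist (g (s - w)) (g (t - w)) = t - s"
        using gd[of "s - w" "t - w"] st 3 by (simp add: l'_def D_def)
      moreover have "1 * (t - s) \<le> (2 * Q + 1) * (t - s)" using Q st by (intro mult_right_mono) auto
      ultimately show ?thesis using 3 st by (simp add: \<beta>'_def)
    qed
  qed
  show thesis
  proof (rule that)
    show "lip_geo (2 * Q + 1) \<beta>' l'" using main D w by (auto simp: lip_geo_def l'_def)
    show "\<beta>' 0 = \<beta> 0" using w by (auto simp: \<beta>'_def)
    show "\<beta>' l' = z"
      using g D by (cases "D = 0") (auto simp: \<beta>'_def l'_def D_def)
    fix u assume u: "0 \<le> u" "u \<le> l'"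
    show "\<beta>' u \<in> \<beta> ` {0..l} \<or> dist (\<beta>' u) z \<le> dist (\<beta> l) z"
    proof (cases "u \<le> w")
      case True then show ?thesis using u w by (auto simp: \<beta>'_def)
    next
      case False
      have "dist (g (u - w)) z = D - (u - w)"
        using gd[of "u - w" D] False u g(2) by (simp add: D_def l'_def)
      then show ?thesis using False wmin[of l] l by (simp add: \<beta>'_def D_def)
    qed
  qed
qed

text \<open>Its \<open>K\<close>-th power consists of chains of \<open>K\<close> jumps, the discrete
  skeleton from which a piecewise geodesic is built.\<close>

definition steps :: "'a::metric_space set \<Rightarrow> real \<Rightarrow> ('a \<times> 'a) set" where
  "steps S \<delta> = {(x, y). x \<in> S \<and> y \<in> S \<and> dist x y \<le> \<delta>}"

text \<open>Starting from a constant path, each jump is one use of \<open>lip_geo_extend\<close>,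
  and \<open>2 * Q + 1 \<le> 3 * Q\<close> for \<open>Q \<ge> 1\<close>. The resulting constant
  depends on the number of jumps only, not on their size \<open>\<delta>\<close>. Newly added points
  are no farther from the new endpoint than the old endpoint was, hence within
  \<open>\<delta>\<close> of \<open>S\<close>.\<close>

lemma steps_lip_geo:
  fixes x :: "'a::metric_space"
  assumes gs: "geodesic_space TYPE('a)" and "(x, y) \<in> steps S \<delta> ^^ K" "x \<in> S" "\<delta> \<ge> 0"
  shows "\<exists>\<beta> l. lip_geo (3 ^ K) \<beta> l \<and> \<beta> 0 = x \<and> \<beta> l = y \<and>
     (\<forall>u\<in>{0..l}. \<exists>v\<in>S. dist (\<beta> u) v \<le> \<delta>)"
  using assms(2)
proof (induction K arbitrary: y)
  case 0
  have "lip_geo (3 ^ 0) (\<lambda>_. x) 0" by (auto simp: lip_geo_def)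
  moreover have "\<exists>v\<in>S. dist x v \<le> \<delta>" using \<open>x \<in> S\<close> \<open>\<delta> \<ge> 0\<close> by (intro bexI[of _ x]) auto
  ultimately show ?case using 0 by (intro exI[of _ "\<lambda>_. x"] exI[of _ 0]) auto
next
  case (Suc K z)
  then obtain y where y: "(x, y) \<in> steps S \<delta> ^^ K" "(y, z) \<in> steps S \<delta>" by auto
  obtain \<beta> l where \<beta>: "lip_geo (3 ^ K) \<beta> l" "\<beta> 0 = x" "\<beta> l = y"
    "\<forall>u\<in>{0..l}. \<exists>v\<in>S. dist (\<beta> u) v \<le> \<delta>" using Suc.IH[OF y(1)] by blast
  obtain \<beta>' l' where b': "lip_geo (2 * 3 ^ K + 1) \<beta>' l'" "\<beta>' 0 = \<beta> 0" "\<beta>' l' = z"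
    "\<And>u. 0 \<le> u \<Longrightarrow> u \<le> l' \<Longrightarrow> \<beta>' u \<in> \<beta> ` {0..l} \<or> dist (\<beta>' u) z \<le> dist (\<beta> l) z"
    using lip_geo_extend[OF gs \<beta>(1), of z] by (metis one_le_power one_le_numeral)
  have "lip_geo (3 ^ Suc K) \<beta>' l'"
    unfolding lip_geo_def
  proof (intro conjI allI impI)
    show "0 \<le> l'" using b' by (auto simp: lip_geo_def)
    fix s t assume st: "0 \<le> s \<and> s \<le> t \<and> t \<le> l'"
    show "dist (\<beta>' s) (\<beta>' t) \<le> t - s" using b'(1) st by (auto simp: lip_geo_def)
    have "t - s \<le> (2 * 3 ^ K + 1) * dist (\<beta>' s) (\<beta>' t)" using b'(1) st by (auto simp: lip_geo_def)
    also have "\<dots> \<le> 3 ^ Suc K * dist (\<beta>' s) (\<beta>' t)"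
      using one_le_power[of "3::real" K] by (intro mult_right_mono) auto
    finally show "t - s \<le> 3 ^ Suc K * dist (\<beta>' s) (\<beta>' t)" .
  qed
  moreover have "\<exists>v\<in>S. dist (\<beta>' u) v \<le> \<delta>" if "u \<in> {0..l'}" for u
    using b'(4)[of u] that \<beta>(3,4) y(2) by (force simp: steps_def)
  ultimately show ?case using b' \<beta> by blast
qed

lemma relpow_steps_mono:
  assumes "(x, y) \<in> steps S \<delta> ^^ K" "S \<subseteq> T"
  shows "(x, y) \<in> steps T \<delta> ^^ K"
  using assms(1)
proof (induction K arbitrary: y)
  case (Suc K)
  then obtain w where "(x, w) \<in> steps S \<delta> ^^ K" "(w, y) \<in> steps S \<delta>" by auto
  then show ?case using Suc.IH[of w] assms(2) by (auto simp: steps_def intro!: relcompI[of x w])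
qed simp

lemma relpow_steps_pad:
  assumes "(x, y) \<in> steps S \<delta> ^^ K" "K \<le> L" "y \<in> S" "\<delta> \<ge> 0"
  shows "(x, y) \<in> steps S \<delta> ^^ L"
proof -
  have "(y, y) \<in> steps S \<delta> ^^ n" for n
    by (induction n) (use assms in \<open>auto simp: steps_def intro: relcompI\<close>)
  then have "(x, y) \<in> steps S \<delta> ^^ (K + (L - K))"
    unfolding relpow_add using assms by (auto intro: relcompI)
  then show ?thesis using assms by simp
qed

section \<open>Detours around a Morse quasi-geodesic\<close>

lemma infdist_compact_attained:
  assumes "compact S" "S \<noteq> {}"
  shows "\<exists>y\<in>S. infdist x S = dist x y"
proof -
  obtain y where "y \<in> S" "\<forall>z\<in>S. dist x y \<le> dist x z"
    using continuous_attains_inf[OF assms, of "dist x"] continuous_on_dist[OF continuous_on_const continuous_on_id, of S x]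
    by auto
  then have "infdist x S = dist x y"
    by (intro antisym infdist_le) (auto simp: infdist_notempty[OF assms(2)] intro!: cINF_greatest assms(2))
  then show ?thesis using \<open>y \<in> S\<close> by blast
qed

text \<open>Every point of \<open>\<beta>\<close> is near \<open>\<gamma>\<close> before
  \<open>c\<close> or near \<open>\<gamma>\<close> after \<open>c\<close>. Both conditions are
  closed and each holds at one end, so by connectedness some \<open>\<beta> u\<close> satisfies
  both. The two nearby points \<open>\<gamma> e\<close> and \<open>\<gamma> f\<close> are then close
  to each other with \<open>e \<le> c \<le> f\<close>, which confines \<open>e\<close> to a bounded
  distance from \<open>c\<close>.\<close>

lemma morse_close:
  assumes \<gamma>: "morse_quasi_geodesic M lam \<kappa> \<gamma> {a..b}" and c: "a \<le> c" "c \<le> b"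
    and \<beta>: "quasi_geodesic Q 0 \<beta> {0..l}" "0 \<le> l" "\<beta> 0 = \<gamma> a" "\<beta> l = \<gamma> b"
  shows "\<exists>u\<in>{0..l}. dist (\<beta> u) (\<gamma> c) \<le> M Q 0 + (lam * (lam * (2 * M Q 0 + \<kappa>)) + \<kappa>)"
proof -
  define M1 where "M1 = M Q 0"
  have lam: "lam \<ge> 1" "\<kappa> \<ge> 0"
    using \<gamma> by (auto simp: morse_quasi_geodesic_def quasi_geodesic_def quasi_geodesic_pair_def)
  have cont: "continuous_on {a..b} \<gamma>"
    using \<gamma> by (auto simp: morse_quasi_geodesic_def quasi_geodesic_def improved_def)
  have contb: "continuous_on {0..l} \<beta>"
    using \<beta> by (auto simp: quasi_geodesic_def improved_def)
  have near: "infdist (\<beta> u) (\<gamma> ` {a..b}) \<le> M1" if "u \<in> {0..l}" for u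
    using \<gamma> \<beta> c that unfolding morse_quasi_geodesic_def morse_def M1_def
    by (meson atLeastAtMost_iff order_trans order_refl)
  have comp: "compact (\<gamma> ` {a'..b'})" if "a \<le> a'" "b' \<le> b" for a' b'
    using that by (intro compact_continuous_image continuous_on_subset[OF cont]) auto
  have attain: "\<exists>e\<in>{a'..b'}. infdist x (\<gamma> ` {a'..b'}) = dist x (\<gamma> e)" if "a \<le> a'" "a' \<le> b'" "b' \<le> b" for a' b' x
    using infdist_compact_attained[of "\<gamma> ` {a'..b'}" x] comp[of a' b'] that by auto
  define A where "A = {u\<in>{0..l}. infdist (\<beta> u) (\<gamma> ` {a..c}) \<le> M1}"
  define B where "B = {u\<in>{0..l}. infdist (\<beta> u) (\<gamma> ` {c..b}) \<le> M1}"
  have clos: "closed {u\<in>{0..l}. infdist (\<beta> u) S \<le> M1}" for S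
    by (intro continuous_on_closed_Collect_le continuous_on_infdist contb continuous_on_const closed_real_atLeastAtMost)
  have M1: "M1 \<ge> 0" using near[of 0] \<beta>(2) infdist_nonneg[of "\<beta> 0" "\<gamma> ` {a..b}"] by simp
  have "0 \<in> A" "l \<in> B" using \<beta> c M1 by (auto simp: A_def B_def)
  moreover have "{0..l} \<subseteq> A \<union> B"
  proof
    fix u assume u: "u \<in> {0..l}"
    obtain e where e: "e \<in> {a..b}" "dist (\<beta> u) (\<gamma> e) \<le> M1" using attain[of a b "\<beta> u"] near[OF u] c by force
    show "u \<in> A \<union> B"
    proof (cases "e \<le> c")
      case True
      then have "infdist (\<beta> u) (\<gamma> ` {a..c}) \<le> M1" using e by (intro infdist_le2[of "\<gamma> e"]) auto
      then show ?thesis using u by (auto simp: A_def)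
    next
      case False
      then have "infdist (\<beta> u) (\<gamma> ` {c..b}) \<le> M1" using e by (intro infdist_le2[of "\<gamma> e"]) auto
      then show ?thesis using u by (auto simp: B_def)
    qed
  qed
  moreover have "closed A" "closed B" unfolding A_def B_def by (rule clos)+
  moreover have "0 \<in> {0..l}" "l \<in> {0..l}" using \<beta>(2) by auto
  ultimately have "A \<inter> B \<inter> {0..l} \<noteq> {}"
    using connected_closedD[OF connected_Icc[of 0 l], of A B] by blast
  then obtain u where u: "u \<in> {0..l}" "u \<in> A" "u \<in> B" by (auto simp: A_def)
  obtain e where e: "e \<in> {a..c}" "dist (\<beta> u) (\<gamma> e) \<le> M1" using attain[of a c "\<beta> u"] u c by (auto simp: A_def)
  obtain f where f: "f \<in> {c..b}" "dist (\<beta> u) (\<gamma> f) \<le> M1" using attain[of c b "\<beta> u"] u c by (auto simp: B_def)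
  have qg: "1 / lam * \<bar>s - t\<bar> - \<kappa> \<le> dist (\<gamma> s) (\<gamma> t) \<and> dist (\<gamma> s) (\<gamma> t) \<le> lam * \<bar>s - t\<bar> + \<kappa>"
    if "s \<in> {a..b}" "t \<in> {a..b}" for s t
    using \<gamma> that by (auto simp: morse_quasi_geodesic_def quasi_geodesic_def)
  have "dist (\<gamma> e) (\<gamma> f) \<le> 2 * M1" using dist_triangle3[of "\<gamma> e" "\<gamma> f" "\<beta> u"] e f by simp
  then have "1 / lam * \<bar>e - f\<bar> \<le> 2 * M1 + \<kappa>" using qg[of e f] e f by auto
  then have "f - e \<le> lam * (2 * M1 + \<kappa>)" using lam e f by (simp add: field_simps)
  then have "lam * (c - e) \<le> lam * (lam * (2 * M1 + \<kappa>))" using lam f by (intro mult_left_mono) auto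
  then have "dist (\<gamma> e) (\<gamma> c) \<le> lam * (lam * (2 * M1 + \<kappa>)) + \<kappa>" using qg[of e c] e c by auto
  then have "dist (\<beta> u) (\<gamma> c) \<le> M1 + (lam * (lam * (2 * M1 + \<kappa>)) + \<kappa>)"
    using dist_triangle[of "\<beta> u" "\<gamma> c" "\<gamma> e"] e by simp
  then show ?thesis using u(1) unfolding M1_def by blast
qed

context path_family
begin

text \<open>The diameter bound \<open>D\<close> limits the parameter length of each segment to
  \<open>l0 * (D + k0)\<close>. Cutting it into \<open>J\<close> pieces of equal parameter length
  makes consecutive cut points \<open>\<delta>\<close>-close.\<close>

lemma polygonal_line_steps:
  assumes "polygonal_line P n \<alpha>" "\<And>x y. x \<in> seg_image \<alpha> \<Longrightarrow> y \<in> seg_image \<alpha> \<Longrightarrow> dist x y \<le> D"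
    and "J \<ge> (1::nat)" "l0 * (l0 * (D + k0) / real J) + k0 \<le> \<delta>"
  shows "(seg_start \<alpha>, seg_end \<alpha>) \<in> steps (seg_image \<alpha>) \<delta> ^^ (n * J)"
proof -
  have seg: "(seg_start p, seg_end p) \<in> steps (seg_image p) \<delta> ^^ J"
    if p: "p \<in> P" and D: "\<And>x y. x \<in> seg_image p \<Longrightarrow> y \<in> seg_image p \<Longrightarrow> dist x y \<le> D" for p
  proof -
    define s where "s = (hi p - lo p) / real J"
    have s: "0 \<le> s" "lo p + real J * s = hi p" using lo_le_hi[OF p] assms(3) by (auto simp: s_def)
    have dom: "lo p + real i * s \<in> {lo p..hi p}" if "i \<le> J" for i
      using s mult_right_mono[of "real i" "real J" s] that by auto
    have "hi p - lo p \<le> l0 * (dist (fn p (lo p)) (fn p (hi p)) + k0)"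
      using path_lower[OF p, of "lo p" "hi p"] lo_le_hi[OF p] by simp
    also have "\<dots> \<le> l0 * (D + k0)"
      using D[of "fn p (lo p)" "fn p (hi p)"] lo_le_hi[OF p] l0 by (intro mult_left_mono) (auto simp: seg_image_def)
    finally have "s \<le> l0 * (D + k0) / real J" unfolding s_def by (intro divide_right_mono) auto
    then have sb: "l0 * s + k0 \<le> \<delta>" using assms(4) mult_left_mono[of s "l0 * (D + k0) / real J" l0] l0 by linarith
    have "(seg_start p, fn p (lo p + real i * s)) \<in> steps (seg_image p) \<delta> ^^ i" if "i \<le> J" for i
      using that
    proof (induction i)
      case 0 then show ?case by (simp add: seg_start_def)
    next
      case (Suc i)
      have "dist (fn p (lo p + real i * s)) (fn p (lo p + real (Suc i) * s)) \<le> l0 * \<bar>(lo p + real i * s) - (lo p + real (Suc i) * s)\<bar> + k0"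
        using Suc.prems by (intro path_upper p dom) auto
      also have "\<bar>(lo p + real i * s) - (lo p + real (Suc i) * s)\<bar> = s" using s by (simp add: algebra_simps)
      finally have "dist (fn p (lo p + real i * s)) (fn p (lo p + real (Suc i) * s)) \<le> \<delta>" using sb by simp
      then have "(fn p (lo p + real i * s), fn p (lo p + real (Suc i) * s)) \<in> steps (seg_image p) \<delta>"
        using dom[of i] dom[of "Suc i"] Suc.prems by (auto simp: steps_def seg_image_def simp del: of_nat_Suc)
      then show ?case using Suc by (auto intro: relcompI simp del: of_nat_Suc)
    qed
    from this[of J] show ?thesis using s by (simp add: seg_end_def)
  qed
  have \<delta>: "\<delta> \<ge> 0" if "D \<ge> 0" using that assms(4) l0 k0 by (smt (verit) divide_nonneg_nonneg mult_nonneg_nonneg of_nat_0_le_iff)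
  show ?thesis
    using assms(1,2)
  proof (induction rule: polygonal_line.induct)
    case (single p n)
    have D: "D \<ge> 0" using single(3)[of "seg_start p" "seg_start p"] seg_start_in_image[OF segment[OF single(1)]] by simp
    show ?case
      using single seg_end_in_image[OF segment[OF single(1)]] \<delta>[OF D]
      by (intro relpow_steps_pad[OF seg]) auto
  next
    case (snoc n \<alpha> p)
    note f = seg_concat_facts[OF polygonal_line_is_segment[OF snoc.hyps(1)] segment[OF snoc.hyps(2)] snoc.hyps(3)]
    have "(seg_start \<alpha>, seg_end \<alpha>) \<in> steps (seg_image (seg_concat \<alpha> p)) \<delta> ^^ (n * J)"
      using snoc.prems by (intro relpow_steps_mono[OF snoc.IH]) (auto simp: f)
    moreover have "(seg_end \<alpha>, seg_end p) \<in> steps (seg_image (seg_concat \<alpha> p)) \<delta> ^^ J"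
      unfolding snoc.hyps(3) using snoc.prems by (intro relpow_steps_mono[OF seg]) (auto simp: f snoc.hyps)
    ultimately have "(seg_start \<alpha>, seg_end p) \<in> steps (seg_image (seg_concat \<alpha> p)) \<delta> ^^ (n * J + J)"
      unfolding relpow_add by (rule relcompI)
    then show ?case by (simp add: f add.commute)
  qed
qed

text \<open>The threshold \<open>R0\<close> must not depend on \<open>\<gamma>\<close>. Navigability
  yields at most \<open>k * N\<close> segments and diameter at most \<open>C * N * R\<close>, so a
  number \<open>K\<close> of jumps fixed before \<open>R\<close> suffices for jumps of size
  \<open>R / (2 * C)\<close>. The piecewise geodesic through them stays more than
  \<open>R / (2 * C)\<close> away from \<open>\<gamma> c\<close>, while \<open>morse_close\<close>
  brings it within \<open>B\<close>, which does not involve \<open>R\<close>.\<close>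

lemma morse_no_detour:
  assumes gs: "geodesic_space TYPE('a)" and nav: "navigable P"
  shows "\<exists>R0. \<forall>R\<ge>R0. \<forall>\<gamma> a b c. a \<le> c \<and> c \<le> b \<and> morse_quasi_geodesic M lam \<kappa> \<gamma> {a..b} \<and>
     dist (\<gamma> a) (\<gamma> c) \<le> 2 * R \<and> dist (\<gamma> b) (\<gamma> c) \<le> 2 * R \<longrightarrow>
     \<not> conn P N {z. R \<le> dist z (\<gamma> c)} (\<gamma> a) (\<gamma> b)"
proof -
  obtain C k where C: "C \<ge> (1::real)" and detour: "\<And>R m n \<alpha>. R \<ge> C \<Longrightarrow> polygonal_line P n \<alpha> \<Longrightarrow>
      infdist m (seg_image \<alpha>) \<ge> R \<Longrightarrow> dist (seg_start \<alpha>) m \<le> 2 * R \<Longrightarrow> dist (seg_end \<alpha>) m \<le> 2 * R \<Longrightarrow>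
      \<exists>p. polygonal_line P (k * n) p \<and> seg_start p = seg_start \<alpha> \<and> seg_end p = seg_end \<alpha> \<and>
          seg_length p \<le> ennreal (C * real n * R) \<and> seg_image p \<inter> cball m (R / C) = {}"
    using nav unfolding navigable_def by blast
  \<comment> \<open>Half of the jump size \<open>R / (2 * C)\<close> is reserved for the additive
    \<open>k0\<close>. This \<open>J\<close> makes the remaining term at most
    \<open>R / (4 * C)\<close> once \<open>k0 \<le> R\<close>.\<close>
  define J where "J = nat \<lceil>4 * C * (l0 * (l0 * (C * real N + 1)))\<rceil>"
  define K where "K = k * N * J"
  define M1 where "M1 = M (3 ^ K) 0"
  define B where "B = M1 + (lam * (lam * (2 * M1 + \<kappa>)) + \<kappa>)"
  \<comment> \<open>In this order: navigability applies, \<open>k0\<close> fits into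
    \<open>R / (4 * C)\<close>, the estimate behind \<open>J\<close> is valid, and
    \<open>B \<le> R / (2 * C)\<close>.\<close>
  define R0 where "R0 = Max {C, 4 * C * k0, k0, 2 * C * B}"
  have pos: "1 \<le> l0 * (l0 * (C * real N + 1))"
  proof -
    have "1 * (1 * 1) \<le> l0 * (l0 * (C * real N + 1))" using l0 C by (intro mult_mono) auto
    then show ?thesis by simp
  qed
  have J: "4 * C * (l0 * (l0 * (C * real N + 1))) \<le> real J" unfolding J_def by (rule real_nat_ceiling_ge)
  have "1 * 1 \<le> (4 * C) * (l0 * (l0 * (C * real N + 1)))" using pos C by (intro mult_mono) auto
  then have J1: "1 \<le> J" using J by linarith
  have False if R: "R \<ge> R0" and c: "a \<le> c" "c \<le> b" and \<gamma>: "morse_quasi_geodesic M lam \<kappa> \<gamma> {a..b}"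
    and near: "dist (\<gamma> a) (\<gamma> c) \<le> 2 * R" "dist (\<gamma> b) (\<gamma> c) \<le> 2 * R"
    and con: "conn P N {z. R \<le> dist z (\<gamma> c)} (\<gamma> a) (\<gamma> b)" for R \<gamma> a b c
  proof -
    have RR: "R \<ge> C" "R \<ge> 4 * C * k0" "R \<ge> k0" "R \<ge> 2 * C * B" using R by (auto simp: R0_def)
    obtain \<alpha> where \<alpha>: "polygonal_line P N \<alpha>" "seg_start \<alpha> = \<gamma> a" "seg_end \<alpha> = \<gamma> b"
       "seg_image \<alpha> \<subseteq> {z. R \<le> dist z (\<gamma> c)}" using con by (auto simp: conn_def)
    have ne: "seg_image \<alpha> \<noteq> {}" using seg_start_in_image[OF polygonal_line_is_segment[OF \<alpha>(1)]] by blast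
    have "infdist (\<gamma> c) (seg_image \<alpha>) \<ge> R"
      unfolding infdist_notempty[OF ne] using \<alpha>(4) by (intro cINF_greatest ne) (auto simp: dist_commute)
    then obtain p where p: "polygonal_line P (k * N) p" "seg_start p = \<gamma> a" "seg_end p = \<gamma> b"
      "seg_length p \<le> ennreal (C * real N * R)" "seg_image p \<inter> cball (\<gamma> c) (R / C) = {}"
      using detour[OF RR(1) \<alpha>(1), of "\<gamma> c"] \<alpha>(2,3) near by metis
    have R0: "R \<ge> 0" using RR C by linarith
    have diam: "dist x y \<le> C * real N * R" if xy: "x \<in> seg_image p" "y \<in> seg_image p" for x y
    proof -
      obtain u v where uv: "u \<in> {lo p..hi p}" "v \<in> {lo p..hi p}" "x = fn p u" "y = fn p v"
        using xy unfolding seg_image_def by blast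
      have "ennreal (dist x y) \<le> ennreal (C * real N * R)"
        using dist_le_curve_length[OF uv(1,2), of "fn p"] p(4) uv(3,4) by (auto simp: seg_length_def intro: order_trans)
      then show ?thesis using R0 C by (subst (asm) ennreal_le_iff) auto
    qed
    have "l0 * (l0 * (C * real N * R + k0)) \<le> l0 * (l0 * (C * real N * R + R))"
      using l0 RR by (intro mult_left_mono) auto
    also have "\<dots> = l0 * (l0 * (C * real N + 1)) * R" by (simp add: algebra_simps)
    also have "\<dots> \<le> real J / (4 * C) * R"
      using J C R0 by (intro mult_right_mono) (auto simp: field_simps)
    finally have "l0 * (l0 * (C * real N * R + k0)) / real J \<le> R / (4 * C)"
      using J1 C by (simp add: field_simps)
    moreover have "k0 \<le> R / (4 * C)" using RR C by (simp add: field_simps)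
    ultimately have step: "l0 * (l0 * (C * real N * R + k0) / real J) + k0 \<le> R / (2 * C)" by simp
    have "(\<gamma> a, \<gamma> b) \<in> steps (seg_image p) (R / (2 * C)) ^^ K"
      using polygonal_line_steps[OF p(1) diam J1 step] p by (simp add: K_def)
    note geo = steps_lip_geo[OF gs this]
    have "\<gamma> a \<in> seg_image p" using seg_start_in_image[OF polygonal_line_is_segment[OF p(1)]] p by simp
    moreover have "R / (2 * C) \<ge> 0" using R0 C by simp
    ultimately obtain \<beta> l where \<beta>: "lip_geo (3 ^ K) \<beta> l" "\<beta> 0 = \<gamma> a" "\<beta> l = \<gamma> b"
      "\<forall>u\<in>{0..l}. \<exists>v\<in>seg_image p. dist (\<beta> u) v \<le> R / (2 * C)"
      using geo by (elim exE conjE meta_impE) assumption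
    have "quasi_geodesic (3 ^ K) 0 \<beta> {0..l}" "0 \<le> l"
      using \<beta>(1) lip_geo_quasi_geodesic[OF \<beta>(1)] by (auto simp: lip_geo_def)
    then obtain u where u: "u \<in> {0..l}" "dist (\<beta> u) (\<gamma> c) \<le> B"
      using morse_close[OF \<gamma> c] \<beta>(2,3) unfolding B_def M1_def by blast
    obtain v where v: "v \<in> seg_image p" "dist (\<beta> u) v \<le> R / (2 * C)" using \<beta>(4) u by blast
    have "R / C < dist v (\<gamma> c)" using p(5) v(1) by (force simp: dist_commute[of v])
    also have "\<dots> \<le> R / (2 * C) + B" using dist_triangle3[of v "\<gamma> c" "\<beta> u"] u v by simp
    also have "\<dots> \<le> R / (2 * C) + R / (2 * C)" using RR C by (simp add: field_simps)
    also have "\<dots> = R / C" using C by (simp add: field_simps)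
    finally show False by simp
  qed
  then show ?thesis by blast
qed

end

section \<open>From local to global: quasi-geodesicity\<close>

text \<open>Here \<open>f\<close> is \<open>\<gamma>\<close> run outwards from the centre
  \<open>f 0\<close>, so that one statement serves both sides. The links go along
  \<open>\<gamma>\<close> from its last exit from the ball of radius \<open>2 * R\<close> up to
  \<open>f r\<close>, across to a nearby point of \<open>j\<close>, and along \<open>j\<close> to
  \<open>f l\<close>. If \<open>l < r\<close>, the first link already reaches
  \<open>f l\<close>.\<close>

lemma (in path_family) conn_along_ray:
  fixes f :: "real \<Rightarrow> 'a"
  assumes l: "0 \<le> l" and r: "0 \<le> r" and cont: "continuous_on {0..l} f"
    and R: "0 < R" "M0 \<le> R" "2 * R \<le> E"
    and far: "2 * R < dist (f l) (f 0)"
    and links: "\<And>a b. 0 \<le> a \<Longrightarrow> a \<le> b \<Longrightarrow> b \<le> l \<Longrightarrow> b - a \<le> r \<Longrightarrow>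
        link P {z. \<exists>e\<in>{a..b}. dist z (f e) \<le> M0} (f a) (f b)"
    and lower: "r \<le> l \<Longrightarrow> 2 * R + spread E + 1 \<le> dist (f r) (f 0)"
    and pass: "r \<le> l \<Longrightarrow> \<exists>j\<in>P. seg_start j = f 0 \<and> seg_end j = f l \<and>
        (\<exists>z\<in>seg_image j. dist z (f r) \<le> 2 * R)"
  shows "\<exists>a. 0 \<le> a \<and> a \<le> l \<and> a \<le> r \<and> dist (f a) (f 0) \<le> 2 * R \<and>
    conn P 3 {z. R \<le> dist z (f 0)} (f a) (f l)"
proof -
  define l1 where "l1 = min l r"
  have l1: "0 \<le> l1" "l1 \<le> l" "l1 \<le> r" using l r by (auto simp: l1_def)
  have spR: "spread (2 * R) \<le> spread E" "0 \<le> spread E" "spread R \<le> spread E"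
    using spread_mono[OF R(3)] spread_ge[of E] spread_mono[of R E] R by auto
  have far1: "2 * R < dist (f l1) (f 0)"
  proof (cases "r \<le> l")
    case True then show ?thesis using lower[OF True] spR by (simp add: l1_def)
  next
    case False then show ?thesis using far by (simp add: l1_def)
  qed
  \<comment> \<open>The maximum \<open>a\<close> of \<open>A\<close> is the last exit time:
    \<open>f a\<close> is still within \<open>2 * R\<close> of the centre, and by continuity
    \<open>f\<close> is at distance at least \<open>2 * R\<close> from \<open>a\<close> on, up to
    \<open>l1\<close>.\<close>
  define A where "A = {a\<in>{0..l1}. dist (f a) (f 0) \<le> 2 * R}"
  have cont1: "continuous_on {0..l1} (\<lambda>a. dist (f a) (f 0))"
    using l1 by (intro continuous_intros continuous_on_subset[OF cont]) auto
  have "closed A" unfolding A_def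
    by (intro continuous_on_closed_Collect_le cont1 continuous_on_const closed_real_atLeastAtMost)
  moreover have "bounded A" by (rule bounded_subset[OF bounded_closed_interval[of 0 l1]]) (auto simp: A_def)
  moreover have "0 \<in> A" using R l1 by (auto simp: A_def)
  ultimately obtain a where a: "a \<in> A" "\<And>b. b \<in> A \<Longrightarrow> b \<le> a"
    using compact_attains_sup[of A] compact_eq_bounded_closed by blast
  have al: "0 \<le> a" "a \<le> l1" "dist (f a) (f 0) \<le> 2 * R" "a \<noteq> l1" using a(1) far1 by (auto simp: A_def)
  have out: "2 * R \<le> dist (f e) (f 0)" if "e \<in> {a..l1}" for e
  proof (rule continuous_ge_on_closure[where S = "{a<..l1}" and f = "\<lambda>a. dist (f a) (f 0)"])
    have cl: "closure {a<..l1} = {a..l1}" using al by (intro closure_greaterThanAtMost) auto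
    show "continuous_on (closure {a<..l1}) (\<lambda>a. dist (f a) (f 0))"
      unfolding cl using al by (intro continuous_on_subset[OF cont1]) auto
    show "e \<in> closure {a<..l1}" using that cl by simp
    fix x assume x: "x \<in> {a<..l1}"
    show "2 * R \<le> dist (f x) (f 0)"
    proof (rule ccontr)
      assume "\<not> 2 * R \<le> dist (f x) (f 0)"
      then have "x \<in> A" using x al by (auto simp: A_def)
      then show False using a(2)[of x] x by auto
    qed
  qed
  have "link P {z. R \<le> dist z (f 0)} (f a) (f l1)"
  proof (rule link_subset[OF links])
    show "{z. \<exists>e\<in>{a..l1}. dist z (f e) \<le> M0} \<subseteq> {z. R \<le> dist z (f 0)}"
    proof clarify
      fix z e assume "e \<in> {a..l1}" "dist z (f e) \<le> M0"
      then show "R \<le> dist z (f 0)" using out[of e] dist_triangle3[of "f e" "f 0" z] R by simp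
    qed
  qed (use al l1 in auto)
  then have c1: "conn P 1 {z. R \<le> dist z (f 0)} (f a) (f l1)" by (rule link_conn)
  have "conn P 3 {z. R \<le> dist z (f 0)} (f a) (f l)"
  proof (cases "r \<le> l")
    case False
    then have "l1 = l" by (simp add: l1_def)
    then show ?thesis using c1 conn_mono by fastforce
  next
    case True
    then have l1r: "l1 = r" by (simp add: l1_def)
    obtain j u where j: "j \<in> P" "seg_start j = f 0" "seg_end j = f l"
      and u: "lo j \<le> u" "u \<le> hi j" "dist (fn j u) (f r) \<le> 2 * R"
      using pass[OF True] unfolding seg_image_def by auto
    have zfar: "spread E + 1 \<le> dist (fn j u) (f 0)"
      using lower[OF True] u dist_triangle3[of "f r" "f 0" "fn j u"] by simp
    have "link P {z. R \<le> dist z (f 0)} (f r) (fn j u)"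
    proof (rule link_subset[OF link_spread])
      show "dist (f r) (fn j u) \<le> 2 * R" using u by (simp add: dist_commute)
      show "cball (f r) (spread (2 * R)) \<subseteq> {z. R \<le> dist z (f 0)}"
      proof
        fix z assume "z \<in> cball (f r) (spread (2 * R))"
        then show "z \<in> {z. R \<le> dist z (f 0)}"
          using lower[OF True] dist_triangle[of "f r" "f 0" z] spR R by simp
      qed
    qed
    then have c2: "conn P (Suc 1) {z. R \<le> dist z (f 0)} (f a) (fn j u)"
      using c1 unfolding l1r by (rule conn_link[rotated])
    have "link P {z. R \<le> dist z (f 0)} (fn j u) (fn j (hi j))"
    proof (rule link_subpath[OF j(1)])
      show "fn j ` {u..hi j} \<subseteq> {z. R \<le> dist z (f 0)}"
      proof clarify
        fix v assume v: "v \<in> {u..hi j}"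
        show "R \<le> dist (fn j v) (f 0)"
        \<comment> \<open>If \<open>j\<close> returned near its start \<open>f 0\<close> at
          \<open>v\<close>, its part up to \<open>v\<close> would have close ends, which forces the
          intermediate point \<open>fn j u\<close> within \<open>spread R\<close> of
          \<open>f 0\<close>.\<close>
        proof (rule ccontr)
          assume "\<not> R \<le> dist (fn j v) (f 0)"
          then have d: "dist (fn j (lo j)) (fn j v) \<le> R" using j(2) by (simp add: seg_start_def dist_commute)
          have "dist (fn j (lo j)) (fn j u) \<le> spread (dist (fn j (lo j)) (fn j v))"
            using path_spread(1)[OF j(1) order_refl, of u v] u v by simp
          also have "\<dots> \<le> spread R" by (rule spread_mono[OF d])
          finally show False using zfar spR j(2) by (simp add: seg_start_def dist_commute)
        qed
      qed
    qed (use u in auto)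
    then have "conn P (Suc (Suc 1)) {z. R \<le> dist z (f 0)} (f a) (fn j (hi j))" using c2 by (rule conn_link[rotated])
    then show ?thesis using j(3) by (simp add: seg_end_def eval_nat_numeral)
  qed
  then show ?thesis using al l1 by (intro exI[of _ a]) auto
qed

text \<open>\<open>R\<close> is the scale of the bypass argument and \<open>r\<close> the scale at which \<open>\<gamma>\<close> is known to be well-behaved.
  Points of \<open>\<gamma>\<close> at parameter distance at least \<open>r\<close> turn out to be \<open>E\<close>-separated. A bypass consists of
  11 segments: at most three along \<open>\<gamma>\<close> on each side and at most five in between.\<close>

locale tame_path = path_family P l0 k0
  for P :: "'a::metric_space segment set" and l0 k0 +
  fixes \<gamma> :: "real \<Rightarrow> 'a" and s0 t0 lam kap M0 R E r :: real
  assumes lam: "1 \<le> lam" and kap: "0 \<le> kap"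
    and cont: "continuous_on {s0..t0} \<gamma>"
    and local_lower: "s0 \<le> a \<Longrightarrow> a \<le> b \<Longrightarrow> b \<le> t0 \<Longrightarrow> b - a \<le> r \<Longrightarrow>
        b - a \<le> lam * (dist (\<gamma> a) (\<gamma> b) + kap)"
    and local_upper: "s0 \<le> a \<Longrightarrow> a \<le> b \<Longrightarrow> b \<le> t0 \<Longrightarrow> b - a \<le> r \<Longrightarrow>
        dist (\<gamma> a) (\<gamma> b) \<le> lam * (b - a) + kap"
    and local_link: "s0 \<le> a \<Longrightarrow> a \<le> b \<Longrightarrow> b \<le> t0 \<Longrightarrow> b - a \<le> r \<Longrightarrow>
        link P {z. \<exists>e\<in>{a..b}. dist z (\<gamma> e) \<le> M0} (\<gamma> a) (\<gamma> b)"
    and local_no_detour: "s0 \<le> a \<Longrightarrow> a \<le> c \<Longrightarrow> c \<le> b \<Longrightarrow> b \<le> t0 \<Longrightarrow> c - a \<le> r \<Longrightarrow> b - c \<le> r \<Longrightarrow>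
        dist (\<gamma> a) (\<gamma> c) \<le> 2 * R \<Longrightarrow> dist (\<gamma> b) (\<gamma> c) \<le> 2 * R \<Longrightarrow>
        \<not> conn P 11 {z. R \<le> dist z (\<gamma> c)} (\<gamma> a) (\<gamma> b)"
    and R: "0 < R" "M0 \<le> R" "lam + kap \<le> 2 * R"
    and E: "spread (2 * R) + R \<le> E" "4 * R + l0 + k0 < E"
    and r: "r = lam * (2 * R + spread E + 1 + kap)"
begin

lemma E_ge: "2 * R \<le> E" "0 \<le> spread E"
proof -
  have "2 * R \<le> spread (2 * R)" using R by (intro spread_ge) simp
  then show "2 * R \<le> E" using E R by linarith
  then show "0 \<le> spread E" using spread_ge[of E] R by linarith
qed

lemma r_ge: "1 \<le> r"
proof -
  have "1 * 1 \<le> lam * (2 * R + spread E + 1 + kap)"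
    using lam R E_ge kap by (intro mult_mono) auto
  then show ?thesis by (simp add: r)
qed

text \<open>\<open>r\<close> is the local lower bound solved for this distance. A path of
  \<open>P\<close> passing within \<open>2 * R\<close> of \<open>\<gamma> (a + r)\<close> therefore
  strays farther than \<open>spread E\<close> from \<open>\<gamma> a\<close>.\<close>

lemma dist_at_r:
  assumes "s0 \<le> a" "a + r \<le> t0"
  shows "2 * R + spread E + 1 \<le> dist (\<gamma> a) (\<gamma> (a + r))"
proof -
  have "lam * (2 * R + spread E + 1 + kap) \<le> lam * (dist (\<gamma> a) (\<gamma> (a + r)) + kap)"
    using local_lower[of a "a + r"] r_ge assms r by simp
  then show ?thesis using lam by simp
qed

text \<open>The passing properties are hypotheses, about pairs having \<open>c\<close> as one end,
  so that the induction in \<open>path_passes_near\<close> can supply them for shorter pieces.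
  Extending five segments by three on each side gives eleven between points of
  \<open>\<gamma>\<close> close enough to \<open>c\<close> for
  \<open>local_no_detour\<close>.\<close>

lemma barrier_if_passing:
  assumes m: "s0 \<le> m1" "m1 \<le> c" "c \<le> m2" "m2 \<le> t0"
    and far: "2 * R < dist (\<gamma> m1) (\<gamma> c)" "2 * R < dist (\<gamma> m2) (\<gamma> c)"
    and left: "r \<le> c - m1 \<Longrightarrow> \<exists>j\<in>P. seg_start j = \<gamma> m1 \<and> seg_end j = \<gamma> c \<and>
        (\<exists>z\<in>seg_image j. dist z (\<gamma> (c - r)) \<le> 2 * R)"
    and right: "r \<le> m2 - c \<Longrightarrow> \<exists>j\<in>P. seg_start j = \<gamma> c \<and> seg_end j = \<gamma> m2 \<and>
        (\<exists>z\<in>seg_image j. dist z (\<gamma> (c + r)) \<le> 2 * R)"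
  shows "\<not> conn P 5 {z. R \<le> dist z (\<gamma> c)} (\<gamma> m1) (\<gamma> m2)"
proof
  assume con: "conn P 5 {z. R \<le> dist z (\<gamma> c)} (\<gamma> m1) (\<gamma> m2)"
  \<comment> \<open>This side of \<open>\<gamma>\<close> is read backwards from \<open>c\<close>, so
    the local links and the paths from \<open>left\<close> get reversed.\<close>
  have "\<exists>a. 0 \<le> a \<and> a \<le> c - m1 \<and> a \<le> r \<and> dist (\<gamma> (c - a)) (\<gamma> (c - 0)) \<le> 2 * R \<and>
    conn P 3 {z. R \<le> dist z (\<gamma> (c - 0))} (\<gamma> (c - a)) (\<gamma> (c - (c - m1)))"
  proof (rule conn_along_ray[where f = "\<lambda>a. \<gamma> (c - a)" and l = "c - m1" and E = E and ?M0.0 = M0])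
    show "continuous_on {0..c - m1} (\<lambda>a. \<gamma> (c - a))"
      using m by (intro continuous_on_compose2[OF cont]) (auto intro!: continuous_intros)
    fix a b assume ab: "0 \<le> a" "a \<le> b" "b \<le> c - m1" "b - a \<le> r"
    have "link P {z. \<exists>e\<in>{c - b..c - a}. dist z (\<gamma> e) \<le> M0} (\<gamma> (c - a)) (\<gamma> (c - b))"
      using ab m by (intro link_sym[OF local_link]) auto
    then show "link P {z. \<exists>e\<in>{a..b}. dist z (\<gamma> (c - e)) \<le> M0} (\<gamma> (c - a)) (\<gamma> (c - b))"
    proof (rule link_subset, safe)
      fix z e assume "e \<in> {c - b..c - a}" "dist z (\<gamma> e) \<le> M0"
      then show "\<exists>e\<in>{a..b}. dist z (\<gamma> (c - e)) \<le> M0" by (intro bexI[of _ "c - e"]) auto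
    qed
  next
    assume rc: "r \<le> c - m1"
    show "2 * R + spread E + 1 \<le> dist (\<gamma> (c - r)) (\<gamma> (c - 0))" using dist_at_r[of "c - r"] rc m by simp
    obtain j z where j: "j \<in> P" "seg_start j = \<gamma> m1" "seg_end j = \<gamma> c" "z \<in> seg_image j" "dist z (\<gamma> (c - r)) \<le> 2 * R"
      using left[OF rc] by blast
    show "\<exists>j\<in>P. seg_start j = \<gamma> (c - 0) \<and> seg_end j = \<gamma> (c - (c - m1)) \<and> (\<exists>z\<in>seg_image j. dist z (\<gamma> (c - r)) \<le> 2 * R)"
      using j seg_reverse_facts[OF segment[OF j(1)]] reverse by (intro bexI[of _ "seg_reverse j"]) auto
  qed (use m R far r_ge E_ge in auto)
  then obtain a where a: "0 \<le> a" "a \<le> c - m1" "a \<le> r" "dist (\<gamma> (c - a)) (\<gamma> c) \<le> 2 * R"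
    "conn P 3 {z. R \<le> dist z (\<gamma> c)} (\<gamma> (c - a)) (\<gamma> m1)" by auto
  have "\<exists>b. 0 \<le> b \<and> b \<le> m2 - c \<and> b \<le> r \<and> dist (\<gamma> (c + b)) (\<gamma> (c + 0)) \<le> 2 * R \<and>
    conn P 3 {z. R \<le> dist z (\<gamma> (c + 0))} (\<gamma> (c + b)) (\<gamma> (c + (m2 - c)))"
  proof (rule conn_along_ray[where f = "\<lambda>a. \<gamma> (c + a)" and l = "m2 - c" and E = E and ?M0.0 = M0])
    show "continuous_on {0..m2 - c} (\<lambda>a. \<gamma> (c + a))"
      using m by (intro continuous_on_compose2[OF cont]) (auto intro!: continuous_intros)
    fix a b assume ab: "0 \<le> a" "a \<le> b" "b \<le> m2 - c" "b - a \<le> r"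
    have "link P {z. \<exists>e\<in>{c + a..c + b}. dist z (\<gamma> e) \<le> M0} (\<gamma> (c + a)) (\<gamma> (c + b))"
      using ab m by (intro local_link) auto
    then show "link P {z. \<exists>e\<in>{a..b}. dist z (\<gamma> (c + e)) \<le> M0} (\<gamma> (c + a)) (\<gamma> (c + b))"
    proof (rule link_subset, safe)
      fix z e assume "e \<in> {c + a..c + b}" "dist z (\<gamma> e) \<le> M0"
      then show "\<exists>e\<in>{a..b}. dist z (\<gamma> (c + e)) \<le> M0" by (intro bexI[of _ "e - c"]) auto
    qed
  next
    assume rc: "r \<le> m2 - c"
    show "2 * R + spread E + 1 \<le> dist (\<gamma> (c + r)) (\<gamma> (c + 0))"
      using dist_at_r[of c] rc m by (simp add: dist_commute)
    show "\<exists>j\<in>P. seg_start j = \<gamma> (c + 0) \<and> seg_end j = \<gamma> (c + (m2 - c)) \<and> (\<exists>z\<in>seg_image j. dist z (\<gamma> (c + r)) \<le> 2 * R)"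
      using right[OF rc] by simp
  qed (use m R far r_ge E_ge in auto)
  then obtain b where b: "0 \<le> b" "b \<le> m2 - c" "b \<le> r" "dist (\<gamma> (c + b)) (\<gamma> c) \<le> 2 * R"
    "conn P 3 {z. R \<le> dist z (\<gamma> c)} (\<gamma> (c + b)) (\<gamma> m2)" by auto
  have "conn P (3 + 5 + 3) {z. R \<le> dist z (\<gamma> c)} (\<gamma> (c - a)) (\<gamma> (c + b))"
    by (rule conn_trans[OF conn_trans[OF a(5) con] conn_sym[OF b(5)]])
  then show False using local_no_detour[of "c - a" c "c + b"] a b m by simp
qed

text \<open>Induction on an integer bound for \<open>t - s\<close>. A path missing the ball about
  \<open>\<gamma> m\<close> is itself a one-segment connection around it, and the induction
  hypothesis on the two sides of \<open>m\<close> activates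
  \<open>barrier_if_passing\<close>.\<close>

lemma path_passes_near:
  assumes "p \<in> P" "seg_start p = \<gamma> s" "seg_end p = \<gamma> t" "s0 \<le> s" "s \<le> m" "m \<le> t" "t \<le> t0"
  shows "\<exists>z\<in>seg_image p. dist z (\<gamma> m) \<le> 2 * R"
proof -
  have "\<forall>s t m p. s0 \<le> s \<and> s \<le> m \<and> m \<le> t \<and> t \<le> t0 \<and> t - s \<le> real n \<and> p \<in> P \<and> seg_start p = \<gamma> s \<and> seg_end p = \<gamma> t
    \<longrightarrow> (\<exists>z\<in>seg_image p. dist z (\<gamma> m) \<le> 2 * R)" for n
  proof (induction n)
    case 0
    show ?case
    proof (intro allI impI, elim conjE)
      fix s t m p
      assume "s \<le> m" "m \<le> t" "t - s \<le> real 0" "p \<in> P" "seg_start p = \<gamma> s"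
      moreover from this have "m = s" by simp
      ultimately show "\<exists>z\<in>seg_image p. dist z (\<gamma> m) \<le> 2 * R"
        using seg_start_in_image[OF segment, of p] R by (intro bexI[of _ "\<gamma> s"]) auto
    qed
  next
    case (Suc n)
    show ?case
    proof (intro allI impI, elim conjE, rule ccontr)
      fix s t m p
      assume b: "s0 \<le> s" "s \<le> m" "m \<le> t" "t \<le> t0" "t - s \<le> real (Suc n)"
        and p: "p \<in> P" "seg_start p = \<gamma> s" "seg_end p = \<gamma> t"
        and "\<not> (\<exists>z\<in>seg_image p. dist z (\<gamma> m) \<le> 2 * R)"
      then have out: "\<And>z. z \<in> seg_image p \<Longrightarrow> 2 * R < dist z (\<gamma> m)" by force
      have far: "2 * R < dist (\<gamma> s) (\<gamma> m)" "2 * R < dist (\<gamma> t) (\<gamma> m)"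
        using out seg_start_in_image[OF segment[OF p(1)]] seg_end_in_image[OF segment[OF p(1)]] p by auto
      \<comment> \<open>Since \<open>lam + kap \<le> 2 * R\<close>, points more than
        \<open>2 * R\<close> apart have parameters at least 1 apart. Hence \<open>m - s\<close> and
        \<open>t - m\<close> are both at most \<open>n\<close>.\<close>
      have gap: "1 \<le> y - x" if "s0 \<le> x" "x \<le> y" "y \<le> t0" "2 * R < dist (\<gamma> x) (\<gamma> y)" for x y
      proof (rule ccontr)
        assume c: "\<not> 1 \<le> y - x"
        then have "dist (\<gamma> x) (\<gamma> y) \<le> lam * (y - x) + kap" using that r_ge by (intro local_upper) auto
        also have "lam * (y - x) \<le> lam * 1" using c lam by (intro mult_left_mono) auto
        finally show False using that R by simp
      qed
      have gaps: "1 \<le> m - s" "1 \<le> t - m" using gap[of s m] gap[of m t] far b by (auto simp: dist_commute)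
      have "\<not> conn P 5 {z. R \<le> dist z (\<gamma> m)} (\<gamma> s) (\<gamma> t)"
      proof (rule barrier_if_passing)
        assume "r \<le> m - s"
        obtain j where j: "j \<in> P" "seg_start j = \<gamma> s" "seg_end j = \<gamma> m" using ex_path by blast
        have "\<exists>z\<in>seg_image j. dist z (\<gamma> (m - r)) \<le> 2 * R"
          using Suc.IH[rule_format, of s "m - r" m j] j b gaps \<open>r \<le> m - s\<close> r_ge by simp
        then show "\<exists>j\<in>P. seg_start j = \<gamma> s \<and> seg_end j = \<gamma> m \<and> (\<exists>z\<in>seg_image j. dist z (\<gamma> (m - r)) \<le> 2 * R)"
          using j by blast
      next
        assume "r \<le> t - m"
        obtain j where j: "j \<in> P" "seg_start j = \<gamma> m" "seg_end j = \<gamma> t" using ex_path by blast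
        have "\<exists>z\<in>seg_image j. dist z (\<gamma> (m + r)) \<le> 2 * R"
          using Suc.IH[rule_format, of m "m + r" t j] j b gaps \<open>r \<le> t - m\<close> r_ge by simp
        then show "\<exists>j\<in>P. seg_start j = \<gamma> m \<and> seg_end j = \<gamma> t \<and> (\<exists>z\<in>seg_image j. dist z (\<gamma> (m + r)) \<le> 2 * R)"
          using j by blast
      qed (use b far in auto)
      moreover have "link P {z. R \<le> dist z (\<gamma> m)} (\<gamma> s) (\<gamma> t)"
        unfolding link_def using p out R by (force intro!: bexI[of _ p])
      then have "conn P 5 {z. R \<le> dist z (\<gamma> m)} (\<gamma> s) (\<gamma> t)" by (auto intro: conn_mono[OF link_conn])
      ultimately show False by blast
    qed
  qed
  from this[of "nat \<lceil>t - s\<rceil>", rule_format, of s m t p] show ?thesis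
    using assms real_nat_ceiling_ge[of "t - s"] by simp
qed

text \<open>A path of \<open>P\<close> from \<open>\<gamma> s\<close> to \<open>\<gamma> t\<close>
  passes near \<open>\<gamma> (s + r)\<close>, so it strays more than \<open>spread E\<close> from
  its start. This is impossible if its ends are at most \<open>E\<close> apart.\<close>

lemma separated:
  assumes "s0 \<le> s" "t \<le> t0" "r \<le> t - s"
  shows "E \<le> dist (\<gamma> s) (\<gamma> t)"
proof (rule ccontr)
  assume "\<not> E \<le> dist (\<gamma> s) (\<gamma> t)"
  then have d: "dist (\<gamma> s) (\<gamma> t) \<le> E" by simp
  obtain p where p: "p \<in> P" "seg_start p = \<gamma> s" "seg_end p = \<gamma> t" using ex_path by blast
  obtain u where u: "lo p \<le> u" "u \<le> hi p" "dist (fn p u) (\<gamma> (s + r)) \<le> 2 * R"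
    using path_passes_near[OF p, of "s + r"] assms r_ge by (auto simp: seg_image_def)
  have "spread E + 1 \<le> dist (\<gamma> s) (fn p u)"
    using dist_at_r[of s] assms u dist_triangle2[of "\<gamma> s" "\<gamma> (s + r)" "fn p u"] by (simp add: dist_commute)
  moreover have "dist (\<gamma> s) (fn p u) \<le> spread (dist (\<gamma> s) (\<gamma> t))"
    using path_spread(1)[OF p(1) order_refl u(1,2) order_refl] p by (simp add: seg_start_def seg_end_def)
  ultimately show False using spread_mono[OF d] by simp
qed

lemma barrier:
  assumes "s0 \<le> m1" "m1 \<le> c" "c \<le> m2" "m2 \<le> t0"
    "2 * R < dist (\<gamma> m1) (\<gamma> c)" "2 * R < dist (\<gamma> m2) (\<gamma> c)"
  shows "\<not> conn P 5 {z. R \<le> dist z (\<gamma> c)} (\<gamma> m1) (\<gamma> m2)"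
proof (rule barrier_if_passing)
  assume "r \<le> c - m1"
  then show "\<exists>j\<in>P. seg_start j = \<gamma> m1 \<and> seg_end j = \<gamma> c \<and> (\<exists>z\<in>seg_image j. dist z (\<gamma> (c - r)) \<le> 2 * R)"
    using ex_path[of "\<gamma> m1" "\<gamma> c"] path_passes_near[of _ m1 c "c - r"] assms r_ge by fastforce
next
  assume "r \<le> m2 - c"
  then show "\<exists>j\<in>P. seg_start j = \<gamma> c \<and> seg_end j = \<gamma> m2 \<and> (\<exists>z\<in>seg_image j. dist z (\<gamma> (c + r)) \<le> 2 * R)"
    using ex_path[of "\<gamma> c" "\<gamma> m2"] path_passes_near[of _ c m2 "c + r"] assms r_ge by fastforce
qed (use assms in auto)

lemma global_upper:
  assumes "s0 \<le> s" "s \<le> t" "t \<le> t0"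
  shows "dist (\<gamma> s) (\<gamma> t) \<le> (lam + kap) * (t - s) + (lam + kap)"
proof -
  have "s0 \<le> s \<and> s \<le> t \<and> t \<le> t0 \<and> t - s \<le> real n \<longrightarrow> dist (\<gamma> s) (\<gamma> t) \<le> (lam + kap) * real n" for n t
  proof (induction n arbitrary: t)
    case 0 then show ?case by auto
  next
    case (Suc n)
    show ?case
    proof
      assume st: "s0 \<le> s \<and> s \<le> t \<and> t \<le> t0 \<and> t - s \<le> real (Suc n)"
      define w where "w = max s (t - 1)"
      have w: "s \<le> w" "w \<le> t" "t - w \<le> 1" "w - s \<le> real n" using st by (auto simp: w_def)
      have "dist (\<gamma> w) (\<gamma> t) \<le> lam * (t - w) + kap" using st w r_ge by (intro local_upper) auto
      also have "lam * (t - w) \<le> lam * 1" using w lam by (intro mult_left_mono) auto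
      finally have "dist (\<gamma> w) (\<gamma> t) \<le> lam + kap" by simp
      moreover have "dist (\<gamma> s) (\<gamma> w) \<le> (lam + kap) * real n" using Suc[of w] st w by auto
      ultimately show "dist (\<gamma> s) (\<gamma> t) \<le> (lam + kap) * real (Suc n)"
        using dist_triangle[of "\<gamma> s" "\<gamma> t" "\<gamma> w"] by (simp add: algebra_simps)
    qed
  qed
  from this[of t "nat \<lceil>t - s\<rceil>"] have "dist (\<gamma> s) (\<gamma> t) \<le> (lam + kap) * real (nat \<lceil>t - s\<rceil>)"
    using assms by (auto simp: real_nat_ceiling_ge)
  also have "\<dots> \<le> (lam + kap) * ((t - s) + 1)"
    using lam kap assms by (intro mult_left_mono) linarith+
  finally show ?thesis by (simp add: algebra_simps)
qed

text \<open>A path \<open>p\<close> of \<open>P\<close> passes within \<open>2 * R\<close> of each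
  sample point \<open>\<gamma> (s + i * r)\<close>. Distinct samples are \<open>E\<close>-separated
  and \<open>E > 4 * R + l0 + k0\<close>, so the passing parameters are more than 1 apart. The
  number of samples is thus bounded by the parameter length of \<open>p\<close>, hence by the
  distance of its ends.\<close>

lemma global_lower:
  assumes "s0 \<le> s" "s \<le> t" "t \<le> t0"
  shows "t - s \<le> r * (l0 * (dist (\<gamma> s) (\<gamma> t) + k0) + 1)"
proof -
  obtain p where p: "p \<in> P" "seg_start p = \<gamma> s" "seg_end p = \<gamma> t" using ex_path by blast
  define n where "n = nat \<lfloor>(t - s) / r\<rfloor>"
  have rn: "real n * r \<le> t - s" "t - s \<le> (real n + 1) * r"
  proof -
    have "real n \<le> (t - s) / r" "(t - s) / r \<le> real n + 1"
      using assms r_ge by (auto simp: n_def of_nat_nat)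
    then show "real n * r \<le> t - s" "t - s \<le> (real n + 1) * r" using r_ge by (auto simp: field_simps)
  qed
  have dom: "s + real i * r \<le> t" if "i \<le> n" for i
    using rn(1) mult_right_mono[of "real i" "real n" r] that r_ge by linarith
  have "\<forall>i\<in>{..n}. \<exists>u. lo p \<le> u \<and> u \<le> hi p \<and> dist (fn p u) (\<gamma> (s + real i * r)) \<le> 2 * R"
  proof
    fix i assume "i \<in> {..n}"
    then show "\<exists>u. lo p \<le> u \<and> u \<le> hi p \<and> dist (fn p u) (\<gamma> (s + real i * r)) \<le> 2 * R"
      using path_passes_near[OF p, of "s + real i * r"] dom[of i] assms r_ge by (auto simp: seg_image_def)
  qed
  then obtain u where u: "\<And>i. i \<le> n \<Longrightarrow> lo p \<le> u i \<and> u i \<le> hi p \<and> dist (fn p (u i)) (\<gamma> (s + real i * r)) \<le> 2 * R"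
    by (metis atMost_iff)
  have sep: "1 < \<bar>u i - u j\<bar>" if ij: "i < j" "j \<le> n" for i j
  proof (rule ccontr)
    assume "\<not> 1 < \<bar>u i - u j\<bar>"
    then have "l0 * \<bar>u i - u j\<bar> \<le> l0 * 1" using l0 by (intro mult_left_mono) auto
    then have "dist (fn p (u i)) (fn p (u j)) \<le> l0 + k0"
      using path_upper[OF p(1), of "u i" "u j"] u[of i] u[of j] ij by auto
    then have "dist (\<gamma> (s + real i * r)) (\<gamma> (s + real j * r)) \<le> 4 * R + l0 + k0"
      using u[of i] u[of j] ij dist_triangle3[of "\<gamma> (s + real i * r)" "\<gamma> (s + real j * r)" "fn p (u i)"]
        dist_triangle[of "fn p (u i)" "\<gamma> (s + real j * r)" "fn p (u j)"] by simp
    moreover have "E \<le> dist (\<gamma> (s + real i * r)) (\<gamma> (s + real j * r))"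
    proof (rule separated)
      have "real i * r + 1 * r \<le> real j * r"
        using ij r_ge by (simp only: distrib_right[symmetric]) (intro mult_right_mono, auto)
      then show "r \<le> s + real j * r - (s + real i * r)" by simp
      show "s0 \<le> s + real i * r" using assms r_ge by (simp add: add_increasing2)
    qed (use dom[of j] assms ij in auto)
    ultimately show False using E by simp
  qed
  \<comment> \<open>Parameters more than 1 apart have distinct floors, so \<open>n + 1\<close>
    integers lie between 0 and the floor of \<open>hi p - lo p\<close>.\<close>
  define g where "g i = \<lfloor>u i - lo p\<rfloor>" for i
  have "inj_on g {..n}"
  proof (rule inj_onI, rule ccontr)
    fix i j assume ij: "i \<in> {..n}" "j \<in> {..n}" "g i = g j" "i \<noteq> j"
    then have "1 < \<bar>u i - u j\<bar>" using sep[of i j] sep[of j i] by (cases i j rule: linorder_cases) auto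
    moreover have "\<bar>u i - u j\<bar> < 1" using ij(3) unfolding g_def by linarith
    ultimately show False by simp
  qed
  moreover have "g ` {..n} \<subseteq> {0..\<lfloor>hi p - lo p\<rfloor>}"
    using u by (auto simp: g_def intro!: floor_mono)
  ultimately have "card {..n} \<le> card {0..\<lfloor>hi p - lo p\<rfloor>}" by (intro card_inj_on_le) auto
  then have "real n \<le> hi p - lo p" using lo_le_hi[OF p(1)] by simp linarith
  also have "\<dots> \<le> l0 * (dist (\<gamma> s) (\<gamma> t) + k0)"
    using path_lower[OF p(1), of "lo p" "hi p"] lo_le_hi[OF p(1)] p by (simp add: seg_start_def seg_end_def)
  finally have "(real n + 1) * r \<le> (l0 * (dist (\<gamma> s) (\<gamma> t) + k0) + 1) * r" using r_ge by (intro mult_right_mono) auto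
  then show ?thesis using rn by (simp add: mult.commute)
qed

end

section \<open>From local to global: the Morse property\<close>

text \<open>A partition is clamped to either side of \<open>c\<close> by \<open>min\<close> and
  \<open>max\<close>. Both clamped sequences keep the index range and stay monotone, so the triangle
  inequality at \<open>c\<close> can be applied term by term without locating \<open>c\<close> in
  the partition.\<close>

lemma curve_length_add:
  assumes "a \<le> c" "c \<le> b"
  shows "curve_length \<gamma> a b \<le> curve_length \<gamma> a c + curve_length \<gamma> c b"
  unfolding curve_length_def[of \<gamma> a b]
proof (rule SUP_least, clarify)
  fix n :: nat and t :: "nat \<Rightarrow> real"
  assume t: "mono_on {..n} t" "t ` {..n} \<subseteq> {a..b}"
  define t1 where "t1 i = min (t i) c" for i
  define t2 where "t2 i = max (t i) c" for i
  let ?S = "\<lambda>t. \<Sum>i<n. ennreal (dist (\<gamma> (t i)) (\<gamma> (t (Suc i))))"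
  have "(n, t1) \<in> {(n, t). mono_on {..n} t \<and> t ` {..n} \<subseteq> {a..c}}"
    using t assms unfolding t1_def mono_on_def by (fastforce simp: image_subset_iff)
  then have "(case (n, t1) of (n, t) \<Rightarrow> \<Sum>i<n. ennreal (dist (\<gamma> (t i)) (\<gamma> (t (Suc i))))) \<le> curve_length \<gamma> a c"
    unfolding curve_length_def by (rule SUP_upper)
  moreover have "(n, t2) \<in> {(n, t). mono_on {..n} t \<and> t ` {..n} \<subseteq> {c..b}}"
    using t assms unfolding t2_def mono_on_def by (fastforce simp: image_subset_iff)
  then have "(case (n, t2) of (n, t) \<Rightarrow> \<Sum>i<n. ennreal (dist (\<gamma> (t i)) (\<gamma> (t (Suc i))))) \<le> curve_length \<gamma> c b"
    unfolding curve_length_def by (rule SUP_upper)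
  moreover have "?S t \<le> ?S t1 + ?S t2"
    unfolding sum.distrib[symmetric]
  proof (rule sum_mono)
    fix i assume "i \<in> {..<n}"
    then have le: "t i \<le> t (Suc i)" using t(1) by (auto simp: mono_on_def)
    have "dist (\<gamma> (t i)) (\<gamma> (t (Suc i))) \<le> dist (\<gamma> (t1 i)) (\<gamma> (t1 (Suc i))) + dist (\<gamma> (t2 i)) (\<gamma> (t2 (Suc i)))"
      using le dist_triangle[of "\<gamma> (t i)" "\<gamma> (t (Suc i))" "\<gamma> c"] by (auto simp: t1_def t2_def min_def max_def)
    then show "ennreal (dist (\<gamma> (t i)) (\<gamma> (t (Suc i)))) \<le> ennreal (dist (\<gamma> (t1 i)) (\<gamma> (t1 (Suc i)))) + ennreal (dist (\<gamma> (t2 i)) (\<gamma> (t2 (Suc i))))"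
      by (simp add: ennreal_plus[symmetric] ennreal_leI del: ennreal_plus)
  qed
  ultimately show "?S t \<le> curve_length \<gamma> a c + curve_length \<gamma> c b"
    by (auto intro: order_trans add_mono)
qed

text \<open>Pieces of parameter length at most 1 are added up. One extra \<open>\<Lambda>\<close>
  comes from the base of the induction, the other from rounding the parameter length up.\<close>

lemma curve_length_linear:
  assumes loc: "\<And>a b. s0 \<le> a \<Longrightarrow> a \<le> b \<Longrightarrow> b \<le> t0 \<Longrightarrow> b - a \<le> 1 \<Longrightarrow> curve_length \<gamma> a b \<le> ennreal \<Lambda>"
    and \<Lambda>: "0 \<le> \<Lambda>" and st: "s0 \<le> t0"
  shows "curve_length \<gamma> s0 t0 \<le> ennreal (\<Lambda> * (t0 - s0) + 2 * \<Lambda>)"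
proof -
  have "s0 \<le> t \<and> t \<le> t0 \<and> t - s0 \<le> real n \<longrightarrow> curve_length \<gamma> s0 t \<le> ennreal (\<Lambda> * (real n + 1))" for n t
  proof (induction n arbitrary: t)
    case 0 then show ?case using loc[of s0 t] by auto
  next
    case (Suc n)
    show ?case
    proof
      assume t: "s0 \<le> t \<and> t \<le> t0 \<and> t - s0 \<le> real (Suc n)"
      define w where "w = max s0 (t - 1)"
      have w: "s0 \<le> w" "w \<le> t" "t - w \<le> 1" "w - s0 \<le> real n" using t by (auto simp: w_def)
      have "curve_length \<gamma> s0 t \<le> curve_length \<gamma> s0 w + curve_length \<gamma> w t" by (rule curve_length_add[OF w(1,2)])
      also have "\<dots> \<le> ennreal (\<Lambda> * (real n + 1)) + ennreal \<Lambda>"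
        using Suc[of w] loc[of w t] t w by (intro add_mono) auto
      also have "\<dots> = ennreal (\<Lambda> * (real (Suc n) + 1))"
        using \<Lambda> by (simp add: ennreal_plus[symmetric] algebra_simps del: ennreal_plus)
      finally show "curve_length \<gamma> s0 t \<le> ennreal (\<Lambda> * (real (Suc n) + 1))" .
    qed
  qed
  from this[of t0 "nat \<lceil>t0 - s0\<rceil>"] have "curve_length \<gamma> s0 t0 \<le> ennreal (\<Lambda> * (real (nat \<lceil>t0 - s0\<rceil>) + 1))"
    using st real_nat_ceiling_ge[of "t0 - s0"] by simp
  also have "\<dots> \<le> ennreal (\<Lambda> * ((t0 - s0 + 1) + 1))"
    using \<Lambda> st by (intro ennreal_leI mult_left_mono add_right_mono) linarith+
  finally show ?thesis by (simp add: algebra_simps)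
qed

section \<open>A coarse projection to \<open>\<gamma>\<close>\<close>

context tame_path
begin

abbreviation "track \<equiv> \<gamma> ` {s0..t0}"

text \<open>The path of \<open>P\<close> from \<open>v\<close> to a nearest point of the track is
  followed until it first comes within \<open>R\<close> of the track. Before that it avoids the
  \<open>R\<close>-neighbourhood, and its ends are \<open>infdist v track\<close> apart, which
  controls how far \<open>z\<close> lies from \<open>v\<close>.\<close>

lemma gate:
  assumes st: "s0 \<le> t0" and v: "R \<le> infdist v track"
  shows "\<exists>z m. m \<in> {s0..t0} \<and> link P {w. R \<le> infdist w track} v z \<and>
    dist z (\<gamma> m) \<le> R \<and> dist v z \<le> spread (infdist v track)"
proof -
  have comp: "compact track" "track \<noteq> {}" using st by (auto intro: compact_continuous_image cont)
  obtain y where y: "y \<in> track" "infdist v track = dist v y" using infdist_compact_attained[OF comp] by blast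
  obtain p where p: "p \<in> P" "seg_start p = v" "seg_end p = y" using ex_path by blast
  have lh: "lo p \<le> hi p" by (rule lo_le_hi[OF p(1)])
  have contp: "continuous_on {lo p..hi p} (\<lambda>u. infdist (fn p u) track)"
    by (intro continuous_on_infdist path_cont p)
  define U where "U = {u\<in>{lo p..hi p}. infdist (fn p u) track \<le> R}"
  have "closed U" unfolding U_def
    by (intro continuous_on_closed_Collect_le contp continuous_on_const closed_real_atLeastAtMost)
  moreover have "bounded U" by (rule bounded_subset[OF bounded_closed_interval[of "lo p" "hi p"]]) (auto simp: U_def)
  moreover have "hi p \<in> U" using p(3) y(1) R lh by (auto simp: U_def seg_end_def)
  ultimately obtain u where u: "u \<in> U" "\<And>x. x \<in> U \<Longrightarrow> u \<le> x"
    using compact_attains_inf[of U] compact_eq_bounded_closed by blast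
  have ul: "lo p \<le> u" "u \<le> hi p" "infdist (fn p u) track \<le> R" using u(1) by (auto simp: U_def)
  have out: "R \<le> infdist (fn p x) track" if x: "x \<in> {lo p..u}" for x
  proof (cases "lo p = u")
    case True
    then show ?thesis using v p(2) x by (simp add: seg_start_def)
  next
    case False
    then have cl: "closure {lo p..<u} = {lo p..u}" using ul by (intro closure_atLeastLessThan) auto
    show ?thesis
    proof (rule continuous_ge_on_closure[where S = "{lo p..<u}" and f = "\<lambda>x. infdist (fn p x) track"])
      show "continuous_on (closure {lo p..<u}) (\<lambda>x. infdist (fn p x) track)"
        unfolding cl using ul by (intro continuous_on_subset[OF contp]) auto
      show "x \<in> closure {lo p..<u}" using x cl by simp
      fix w assume w: "w \<in> {lo p..<u}"
      show "R \<le> infdist (fn p w) track"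
      proof (rule ccontr)
        assume "\<not> R \<le> infdist (fn p w) track"
        then have "w \<in> U" using w ul by (auto simp: U_def)
        then show False using u(2)[of w] w by auto
      qed
    qed
  qed
  have "link P {w. R \<le> infdist w track} (fn p (lo p)) (fn p u)"
    using out ul by (intro link_subpath[OF p(1)]) auto
  moreover obtain m where "m \<in> {s0..t0}" "infdist (fn p u) track = dist (fn p u) (\<gamma> m)"
    using infdist_compact_attained[OF comp, of "fn p u"] by blast
  moreover have "dist v (fn p u) \<le> spread (infdist v track)"
    using path_spread(1)[OF p(1) order_refl ul(1,2) order_refl] p y by (simp add: seg_start_def seg_end_def)
  ultimately show ?thesis using ul p(2) by (auto simp: seg_start_def)
qed

text \<open>Were the gates far apart along \<open>\<gamma>\<close>, some \<open>\<gamma> c\<close>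
  between them would be \<open>E\<close>-separated from both. The five links from
  \<open>\<gamma> m\<close> through \<open>z\<close>, \<open>v\<close>, \<open>v'\<close> and
  \<open>z'\<close> to \<open>\<gamma> m'\<close> would then avoid its \<open>R\<close>-ball,
  against \<open>barrier\<close>.\<close>

lemma gate_step_aux:
  assumes m: "s0 \<le> m" "m \<le> m'" "m' \<le> t0"
    and v: "link P {w. R \<le> infdist w track} v z" "dist z (\<gamma> m) \<le> R"
    and v': "link P {w. R \<le> infdist w track} v' z'" "dist z' (\<gamma> m') \<le> R"
    and vv': "link P {w. R \<le> infdist w track} v v'"
  shows "m' - m \<le> 2 * r"
proof (rule ccontr)
  assume far: "\<not> m' - m \<le> 2 * r"
  define c where "c = m + r"
  have c: "m \<le> c" "c \<le> m'" "r \<le> c - m" "r \<le> m' - c" using far r_ge by (auto simp: c_def)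
  have sep: "E \<le> dist (\<gamma> m) (\<gamma> c)" "E \<le> dist (\<gamma> m') (\<gamma> c)"
    using separated[of m c] separated[of c m'] c m by (auto simp: dist_commute)
  let ?S = "{w. R \<le> dist w (\<gamma> c)}"
  have sub: "{w. R \<le> infdist w track} \<subseteq> ?S"
  proof clarify
    fix w assume "R \<le> infdist w track"
    also have "infdist w track \<le> dist w (\<gamma> c)" using c m by (intro infdist_le) auto
    finally show "R \<le> dist w (\<gamma> c)" .
  qed
  have sp: "spread R + R \<le> E" using E spread_mono[of R "2 * R"] R by simp
  have short: "link P ?S (\<gamma> x) y" if "E \<le> dist (\<gamma> x) (\<gamma> c)" "dist y (\<gamma> x) \<le> R" for x y
  proof (rule link_subset[OF link_spread])
    show "dist (\<gamma> x) y \<le> R" using that by (simp add: dist_commute)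
    show "cball (\<gamma> x) (spread R) \<subseteq> ?S"
    proof
      fix w assume "w \<in> cball (\<gamma> x) (spread R)"
      then show "w \<in> ?S" using that sp dist_triangle[of "\<gamma> x" "\<gamma> c" w] by simp
    qed
  qed
  have "conn P 1 ?S (\<gamma> m) z" by (rule link_conn[OF short[OF sep(1) v(2)]])
  then have "conn P (Suc 1) ?S (\<gamma> m) v" by (rule conn_link[OF _ link_sym[OF link_subset[OF v(1) sub]]])
  then have "conn P (Suc (Suc 1)) ?S (\<gamma> m) v'" by (rule conn_link[OF _ link_subset[OF vv' sub]])
  then have "conn P (Suc (Suc (Suc 1))) ?S (\<gamma> m) z'" by (rule conn_link[OF _ link_subset[OF v'(1) sub]])
  then have "conn P (Suc (Suc (Suc (Suc 1)))) ?S (\<gamma> m) (\<gamma> m')"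
    by (rule conn_link[OF _ link_sym[OF short[OF sep(2) v'(2)]]])
  then have "conn P 5 ?S (\<gamma> m) (\<gamma> m')" by (simp add: eval_nat_numeral)
  moreover have "2 * R < E" using E R l0 k0 by linarith
  ultimately show False using barrier[of m c m'] sep c m by auto
qed

lemma gate_step:
  assumes "m \<in> {s0..t0}" "m' \<in> {s0..t0}"
    and "link P {w. R \<le> infdist w track} v z" "dist z (\<gamma> m) \<le> R"
    and "link P {w. R \<le> infdist w track} v' z'" "dist z' (\<gamma> m') \<le> R"
    and "link P {w. R \<le> infdist w track} v v'"
  shows "\<bar>m' - m\<bar> \<le> 2 * r"
  using gate_step_aux[of m m' v z v' z'] gate_step_aux[of m' m v' z' v z] assms link_sym[OF assms(7)]
  by (cases "m \<le> m'") auto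

end

section \<open>An explicit Morse gauge\<close>

context path_family
begin

text \<open>Above \<open>height\<close>, a \<open>(Q, q)\<close>-quasi-geodesic can be cut into pieces of parameter length \<open>2 * Q * B\<close>
  such that the path of \<open>P\<close> between the ends of a piece stays at distance \<open>R\<close> from \<open>\<gamma>\<close>. The piece length is
  such that advancing by \<open>B\<close> along \<open>\<gamma>\<close> per piece covers only half of the required distance.\<close>

definition height :: "real \<Rightarrow> real \<Rightarrow> real \<Rightarrow> real \<Rightarrow> real" where
  "height R B Q q = R + spread (Q * (2 * Q * B) + q)"

text \<open>The solution for \<open>x\<close> of the equation
  \<open>x / Q - q = x / (2 * Q) + 2 * (spread H + R) + B + D\<close>, where \<open>H\<close> is the
  height. The left side is the least displacement of the quasi-geodesic, the right side the
  displacement possible through the gates.\<close>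

definition excursion :: "real \<Rightarrow> real \<Rightarrow> real \<Rightarrow> real \<Rightarrow> real \<Rightarrow> real" where
  "excursion R B D Q q = 2 * Q * (q + 2 * (spread (height R B Q q) + R) + B + D)"

text \<open>The height at which an excursion starts, plus the distance a
  \<open>(Q, q)\<close>-quasi-geodesic can cover during it.\<close>

definition morse_bound :: "real \<Rightarrow> real \<Rightarrow> real \<Rightarrow> real \<Rightarrow> real \<Rightarrow> real" where
  "morse_bound R B D Q q = height R B Q q + (Q * excursion R B D Q q + q)"

lemma spread_nonneg: "0 \<le> d \<Longrightarrow> 0 \<le> spread d"
  using spread_ge[of d] by simp

lemma
  assumes "0 \<le> R" "0 \<le> B" "0 \<le> D" "1 \<le> Q" "0 \<le> q"
  shows height_ge: "R \<le> height R B Q q"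
    and excursion_nonneg: "0 \<le> excursion R B D Q q"
    and morse_bound_nonneg: "0 \<le> morse_bound R B D Q q"
proof -
  show h: "R \<le> height R B Q q" using assms by (auto simp: height_def intro!: spread_nonneg)
  then show e: "0 \<le> excursion R B D Q q"
    using assms by (auto simp: excursion_def intro!: mult_nonneg_nonneg add_nonneg_nonneg spread_nonneg)
  show "0 \<le> morse_bound R B D Q q" using assms h e by (auto simp: morse_bound_def intro!: add_nonneg_nonneg)
qed

lemma morse_bound_mono:
  assumes "0 \<le> R" "0 \<le> B" "0 \<le> D" "1 \<le> Q" "Q \<le> Q'" "0 \<le> q" "q \<le> q'"
  shows "morse_bound R B D Q q \<le> morse_bound R B D Q' q'"
proof -
  have h: "height R B Q q \<le> height R B Q' q'"
    unfolding height_def using assms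
    by (intro add_left_mono spread_mono add_mono mult_mono) auto
  have e: "excursion R B D Q q \<le> excursion R B D Q' q'"
    unfolding excursion_def using assms h height_ge[of R B D Q q]
    by (intro mult_mono add_mono spread_mono order_refl) (auto intro!: add_nonneg_nonneg spread_nonneg)
  show ?thesis
    unfolding morse_bound_def using assms h e excursion_nonneg[of R B D Q q]
    by (intro add_mono mult_mono) auto
qed

lemma morse_gauge_morse_bound:
  assumes "0 \<le> R" "0 \<le> B" "0 \<le> D"
  shows "morse_gauge (morse_bound R B D)"
  unfolding morse_gauge_def
proof (intro conjI allI impI)
  fix Q q :: real assume "1 \<le> Q" "0 \<le> q"
  then show "0 \<le> morse_bound R B D Q q" using morse_bound_nonneg assms by blast
next
  fix q :: real assume "0 \<le> q"
  then show "mono_on {1..} (\<lambda>Q. morse_bound R B D Q q)" using assms by (auto intro!: mono_onI morse_bound_mono)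
next
  fix Q :: real assume "1 \<le> Q"
  then show "mono_on {0..} (morse_bound R B D Q)" using assms by (auto intro!: mono_onI morse_bound_mono)
  show "continuous_on {0..} (morse_bound R B D Q)"
    unfolding morse_bound_def excursion_def height_def spread_def by (intro continuous_intros)
qed

end

section \<open>Excursions of a quasi-geodesic away from \<open>\<gamma>\<close>\<close>

context tame_path
begin

text \<open>By \<open>gate_step\<close>, the gate moves by at most \<open>2 * r\<close> in parameter
  per piece of length at most \<open>\<tau>\<close>, contributing at most \<open>B\<close> to the
  bound from \<open>global_upper\<close>. As \<open>\<tau> = 2 * Q * B\<close>, the drift is
  \<open>(b - a) / (2 * Q)\<close> plus a constant, half the main term of the lower bound for
  \<open>\<sigma>\<close>.\<close>

lemma excursion_bound:
  assumes \<sigma>: "quasi_geodesic Q q \<sigma> {c..d}" and ab: "c \<le> a" "a < b" "b \<le> d" and st: "s0 \<le> t0"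
  defines "B \<equiv> (lam + kap) * (2 * r)"
  defines "H \<equiv> height R B Q q"
  assumes ends: "infdist (\<sigma> a) track \<le> H" "infdist (\<sigma> b) track \<le> H"
    and out: "\<And>x. x \<in> {a..b} \<Longrightarrow> H \<le> infdist (\<sigma> x) track"
  shows "b - a \<le> excursion R B (lam + kap) Q q"
proof -
  have Q: "1 \<le> Q" "0 \<le> q"
    and \<sigma>_upper: "\<And>s t. s \<in> {c..d} \<Longrightarrow> t \<in> {c..d} \<Longrightarrow> dist (\<sigma> s) (\<sigma> t) \<le> Q * \<bar>s - t\<bar> + q"
    and \<sigma>_lower: "\<And>s t. s \<in> {c..d} \<Longrightarrow> t \<in> {c..d} \<Longrightarrow> 1 / Q * \<bar>s - t\<bar> - q \<le> dist (\<sigma> s) (\<sigma> t)"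
    using \<sigma> by (auto simp: quasi_geodesic_def quasi_geodesic_pair_def)
  have "1 * (2 * 1) \<le> (lam + kap) * (2 * r)" using lam kap r_ge by (intro mult_mono) auto
  then have B: "2 \<le> B" by (simp add: B_def)
  define \<tau> where "\<tau> = 2 * Q * B"
  have "2 * 1 * 2 \<le> 2 * Q * B" using Q B by (intro mult_mono) auto
  then have \<tau>: "4 \<le> \<tau>" by (simp add: \<tau>_def)
  have H: "H = R + spread (Q * \<tau> + q)" by (simp add: H_def height_def \<tau>_def)
  have HR: "R \<le> H" unfolding H_def using R Q B by (intro height_ge[where D = 0]) auto
  have "\<forall>x\<in>{a..b}. \<exists>z m. m \<in> {s0..t0} \<and> link P {w. R \<le> infdist w track} (\<sigma> x) z \<and>
    dist z (\<gamma> m) \<le> R \<and> dist (\<sigma> x) z \<le> spread (infdist (\<sigma> x) track)"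
    using gate[OF st] out HR order_trans by blast
  then obtain z m where gates: "\<And>x. x \<in> {a..b} \<Longrightarrow> m x \<in> {s0..t0} \<and>
    link P {w. R \<le> infdist w track} (\<sigma> x) (z x) \<and>
    dist (z x) (\<gamma> (m x)) \<le> R \<and> dist (\<sigma> x) (z x) \<le> spread (infdist (\<sigma> x) track)" by metis
  \<comment> \<open>Rounding up makes the pieces no longer than \<open>\<tau>\<close> and costs one
    additive \<open>B\<close> in the drift.\<close>
  define n where "n = nat \<lceil>(b - a) / \<tau>\<rceil>"
  have quot: "0 < (b - a) / \<tau>" using ab \<tau> by simp
  have n: "(b - a) / \<tau> \<le> real n" "real n \<le> (b - a) / \<tau> + 1"
    using quot unfolding n_def by linarith+
  have n0: "0 < real n" using n quot by linarith
  define x where "x i = a + real i * ((b - a) / real n)" for i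
  have xn: "x 0 = a" "x n = b" using n0 by (auto simp: x_def)
  have xdom: "x i \<in> {a..b}" if "i \<le> n" for i
    using ab n0 that mult_right_mono[of "real i" "real n" "(b - a) / real n"] by (auto simp: x_def)
  have hop: "\<bar>m (x (Suc i)) - m (x i)\<bar> \<le> 2 * r" if i: "i < n" for i
  proof -
    have dom: "x i \<in> {a..b}" "x (Suc i) \<in> {a..b}" using xdom i by auto
    have "x (Suc i) - x i = (b - a) / real n" by (simp add: x_def distrib_right add_divide_distrib)
    then have "\<bar>x i - x (Suc i)\<bar> = (b - a) / real n" using ab n0 by (subst abs_minus_commute) simp
    also have "\<dots> \<le> \<tau>" using n(1) n0 \<tau> by (simp add: field_simps)
    finally have "Q * \<bar>x i - x (Suc i)\<bar> \<le> Q * \<tau>" using Q by (intro mult_left_mono) auto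
    then have close: "dist (\<sigma> (x i)) (\<sigma> (x (Suc i))) \<le> Q * \<tau> + q"
      using \<sigma>_upper[of "x i" "x (Suc i)"] dom ab by auto
    \<comment> \<open>The path starts at height at least \<open>H\<close>, and \<open>H\<close>
      exceeds \<open>R\<close> by exactly the amount such a path can stray.\<close>
    have "link P {w. R \<le> infdist w track} (\<sigma> (x i)) (\<sigma> (x (Suc i)))"
    proof (rule link_subset[OF link_spread[OF close]])
      show "cball (\<sigma> (x i)) (spread (Q * \<tau> + q)) \<subseteq> {w. R \<le> infdist w track}"
      proof
        fix w assume "w \<in> cball (\<sigma> (x i)) (spread (Q * \<tau> + q))"
        then show "w \<in> {w. R \<le> infdist w track}"
          using out[OF dom(1)] infdist_triangle[of "\<sigma> (x i)" track w] H by simp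
      qed
    qed
    then show ?thesis using gates[OF dom(1)] gates[OF dom(2)]
      by (intro gate_step[of _ _ "\<sigma> (x i)" "z (x i)" "\<sigma> (x (Suc i))" "z (x (Suc i))"]) auto
  qed
  have "\<bar>m (x i) - m a\<bar> \<le> real i * (2 * r)" if "i \<le> n" for i
    using that
  proof (induction i)
    case 0 then show ?case using xn by simp
  next
    case (Suc i)
    then have "\<bar>m (x i) - m a\<bar> \<le> real i * (2 * r)" "\<bar>m (x (Suc i)) - m (x i)\<bar> \<le> 2 * r" using hop[of i] by auto
    then show ?case by (simp add: algebra_simps)
  qed
  from this[of n] have mm: "\<bar>m b - m a\<bar> \<le> real n * (2 * r)" using xn by simp
  have ga: "m a \<in> {s0..t0}" "dist (\<sigma> a) (\<gamma> (m a)) \<le> spread H + R"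
    using gates[of a] ab spread_mono[OF ends(1)] dist_triangle[of "\<sigma> a" "\<gamma> (m a)" "z a"] by auto
  have gb: "m b \<in> {s0..t0}" "dist (\<sigma> b) (\<gamma> (m b)) \<le> spread H + R"
    using gates[of b] ab spread_mono[OF ends(2)] dist_triangle[of "\<sigma> b" "\<gamma> (m b)" "z b"] by auto
  have "dist (\<gamma> (m a)) (\<gamma> (m b)) \<le> (lam + kap) * \<bar>m b - m a\<bar> + (lam + kap)"
    using global_upper[of "m a" "m b"] global_upper[of "m b" "m a"] ga gb
    by (cases "m a \<le> m b") (auto simp: dist_commute)
  also have "\<dots> \<le> (lam + kap) * (real n * (2 * r)) + (lam + kap)"
    using mm lam kap by (intro add_right_mono mult_left_mono) auto
  also have "(lam + kap) * (real n * (2 * r)) = B * real n" by (simp add: B_def)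
  also have "\<dots> \<le> B * ((b - a) / \<tau> + 1)" using n(2) B by (intro mult_left_mono) auto
  also have "\<dots> = (b - a) / (2 * Q) + B" using B Q by (simp add: \<tau>_def field_simps)
  finally have m_dist: "dist (\<gamma> (m a)) (\<gamma> (m b)) \<le> (b - a) / (2 * Q) + B + (lam + kap)" by simp
  define y where "y = (b - a) / (2 * Q)"
  have "dist (\<sigma> a) (\<sigma> b) \<le> dist (\<sigma> a) (\<gamma> (m a)) + (dist (\<gamma> (m a)) (\<gamma> (m b)) + dist (\<sigma> b) (\<gamma> (m b)))"
    using dist_triangle[of "\<sigma> a" "\<sigma> b" "\<gamma> (m a)"] dist_triangle2[of "\<gamma> (m a)" "\<sigma> b" "\<gamma> (m b)"]
    by linarith
  also have "\<dots> \<le> (spread H + R) + ((y + B + (lam + kap)) + (spread H + R))"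
    using ga(2) gb(2) m_dist[folded y_def] by (intro add_mono)
  finally have "dist (\<sigma> a) (\<sigma> b) \<le> 2 * (spread H + R) + y + B + (lam + kap)" by simp
  moreover have "2 * y - q \<le> dist (\<sigma> a) (\<sigma> b)" proof -
    have "2 * y = (b - a) / Q" using Q by (simp add: y_def field_simps)
    then show ?thesis using \<sigma>_lower[of a b] ab by simp
  qed
  ultimately have "y \<le> q + 2 * (spread H + R) + B + (lam + kap)" by simp
  then have "2 * Q * y \<le> 2 * Q * (q + 2 * (spread H + R) + B + (lam + kap))" using Q by (intro mult_left_mono) auto
  moreover have "2 * Q * y = b - a" using Q by (simp add: y_def field_simps)
  ultimately show ?thesis unfolding excursion_def H_def by simp
qed

text \<open>Both ends of \<open>\<sigma>\<close> lie on the track. If \<open>\<sigma> u\<close> is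
  above height \<open>H\<close>, let \<open>a\<close> be the last parameter before \<open>u\<close>
  and \<open>b\<close> the first one after \<open>u\<close> at height at most \<open>H\<close>. Then
  \<open>excursion_bound\<close> limits \<open>b - a\<close>, and with it the distance from
  \<open>\<sigma> u\<close> to \<open>\<sigma> a\<close>.\<close>

lemma global_morse:
  assumes \<sigma>: "quasi_geodesic Q q \<sigma> {c..d}" "c \<le> d" "\<sigma> c = \<gamma> s0" "\<sigma> d = \<gamma> t0"
    and st: "s0 \<le> t0" and u: "u \<in> {c..d}"
  shows "infdist (\<sigma> u) track \<le> morse_bound R ((lam + kap) * (2 * r)) (lam + kap) Q q"
proof -
  define B where "B = (lam + kap) * (2 * r)"
  define H where "H = height R B Q q"
  define W where "W = excursion R B (lam + kap) Q q"
  have Q: "1 \<le> Q" "0 \<le> q"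
    and \<sigma>_upper: "\<And>s t. s \<in> {c..d} \<Longrightarrow> t \<in> {c..d} \<Longrightarrow> dist (\<sigma> s) (\<sigma> t) \<le> Q * \<bar>s - t\<bar> + q"
    and cont\<sigma>: "continuous_on {c..d} \<sigma>"
    using \<sigma> by (auto simp: quasi_geodesic_def quasi_geodesic_pair_def improved_def)
  have B: "0 \<le> B" using lam kap r_ge by (simp add: B_def)
  have HW: "R \<le> H" "0 \<le> W" unfolding H_def W_def
    using R B Q lam kap by (intro height_ge[where D = 0] excursion_nonneg; simp)+
  have QW: "0 \<le> Q * W" using Q HW by simp
  have goal: "infdist (\<sigma> u) track \<le> H + (Q * W + q)"
  proof (cases "infdist (\<sigma> u) track \<le> H")
    case True
    then show ?thesis using QW Q by simp
  next
    case False
    let ?h = "\<lambda>x. infdist (\<sigma> x) track"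
    have conth: "continuous_on {c..d} ?h" by (intro continuous_on_infdist cont\<sigma>)
    have sub: "compact {x\<in>{a'..b'}. ?h x \<le> H}" if "c \<le> a'" "b' \<le> d" for a' b'
    proof -
      have "closed {x\<in>{a'..b'}. ?h x \<le> H}" using that
        by (intro continuous_on_closed_Collect_le continuous_on_subset[OF conth] continuous_on_const closed_real_atLeastAtMost) auto
      moreover have "bounded {x\<in>{a'..b'}. ?h x \<le> H}"
        by (rule bounded_subset[OF bounded_closed_interval[of a' b']]) auto
      ultimately show ?thesis by (simp add: compact_eq_bounded_closed)
    qed
    have "c \<in> {x\<in>{c..u}. ?h x \<le> H}" "d \<in> {x\<in>{u..d}. ?h x \<le> H}" using \<sigma> u st HW R by auto
    then have ne: "{x\<in>{c..u}. ?h x \<le> H} \<noteq> {}" "{x\<in>{u..d}. ?h x \<le> H} \<noteq> {}" by blast+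
    have "compact {x\<in>{c..u}. ?h x \<le> H}" "compact {x\<in>{u..d}. ?h x \<le> H}" using u by (intro sub; simp)+
    then obtain a b where a: "a \<in> {x\<in>{c..u}. ?h x \<le> H}" "\<And>x. x \<in> {x\<in>{c..u}. ?h x \<le> H} \<Longrightarrow> x \<le> a"
      and b: "b \<in> {x\<in>{u..d}. ?h x \<le> H}" "\<And>x. x \<in> {x\<in>{u..d}. ?h x \<le> H} \<Longrightarrow> b \<le> x"
      using compact_attains_sup[OF _ ne(1)] compact_attains_inf[OF _ ne(2)] by blast
    have ab: "c \<le> a" "a < u" "u < b" "b \<le> d" using a(1) b(1) False by (auto simp: less_le)
    have cl: "closure {a<..<b} = {a..b}" using ab by (intro closure_greaterThanLessThan) auto
    have out: "H \<le> ?h x" if x: "x \<in> {a..b}" for x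
    proof (rule continuous_ge_on_closure[where S = "{a<..<b}" and f = ?h])
      show "continuous_on (closure {a<..<b}) ?h"
        unfolding cl using ab by (intro continuous_on_subset[OF conth]) auto
      show "x \<in> closure {a<..<b}" using x cl by simp
      fix w assume w: "w \<in> {a<..<b}"
      show "H \<le> ?h w"
      proof (rule ccontr)
        assume w': "\<not> H \<le> ?h w"
        show False
        proof (cases "w \<le> u")
          case True
          then show False using a(2)[of w] w w' ab by auto
        next
          case False
          then show False using b(2)[of w] w w' ab by auto
        qed
      qed
    qed
    have "b - a \<le> W"
      unfolding W_def B_def
    proof (rule excursion_bound[OF \<sigma>(1)])
      show "infdist (\<sigma> a) track \<le> height R ((lam + kap) * (2 * r)) Q q"
        "infdist (\<sigma> b) track \<le> height R ((lam + kap) * (2 * r)) Q q"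
        using a(1) b(1) by (auto simp: H_def B_def)
    qed (use ab st out in \<open>auto simp: H_def B_def\<close>)
    then have "Q * \<bar>u - a\<bar> \<le> Q * W" using Q ab by (intro mult_left_mono) auto
    then have "dist (\<sigma> u) (\<sigma> a) \<le> Q * W + q" using \<sigma>_upper[of u a] ab u by auto
    then show ?thesis using a(1) infdist_triangle[of "\<sigma> u" track "\<sigma> a"] by simp
  qed
  then show ?thesis by (simp add: morse_bound_def H_def W_def B_def)
qed

end

section \<open>Choice of constants and conclusion\<close>

lemma path_family_of:
  assumes "path_system P" "undirected P"
  shows "\<exists>l0 k0. path_family P l0 k0"
proof -
  obtain l0 k0 where "quasi_geodesic_pair l0 k0" "\<forall>p\<in>P. quasi_geodesic l0 k0 (fn p) {lo p..hi p}"
    using assms(1) unfolding path_system_def by blast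
  then have "path_family P l0 k0"
    using assms unfolding path_system_def undirected_def quasi_geodesic_pair_def path_family_def by blast
  then show ?thesis by blast
qed

text \<open>The constants are fixed in the order \<open>M0\<close>, \<open>R\<close>,
  \<open>E\<close>, \<open>r\<close> from \<open>P\<close>, \<open>M\<close> and the given pair,
  before any \<open>\<gamma>\<close>. Every compact piece of a locally Morse path is then a
  \<open>tame_path\<close> with these same constants, so the estimates are uniform even on an
  unbounded \<open>I\<close>.\<close>

lemma (in path_family) local_to_global:
  assumes gs: "geodesic_space TYPE('a)" and nav: "navigable P"
    and pair: "quasi_geodesic_pair lam kap"
  shows "\<exists>L lam' kap' M'. L > 0 \<and> quasi_geodesic_pair lam' kap' \<and> morse_gauge M' \<and>
           (\<forall>(\<gamma> :: real \<Rightarrow> 'a) I. is_interval I \<and> continuous_on I \<gamma> \<and>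
                locally_at_scale L (morse_quasi_geodesic M lam kap) \<gamma> I \<longrightarrow>
              morse_quasi_geodesic M' lam' kap' \<gamma> I)"
proof -
  have lam: "1 \<le> lam" "0 \<le> kap" using pair by (auto simp: quasi_geodesic_pair_def)
  \<comment> \<open>A path of \<open>P\<close> with ends on a Morse piece of \<open>\<gamma>\<close>
    is an \<open>(l0, k0)\<close>-quasi-geodesic, so it stays within \<open>M l0 k0\<close> of that
    piece.\<close>
  define M0 where "M0 = M l0 k0"
  obtain R0 where R0: "\<And>R \<gamma> a b c. R0 \<le> R \<Longrightarrow> a \<le> c \<Longrightarrow> c \<le> b \<Longrightarrow> morse_quasi_geodesic M lam kap \<gamma> {a..b} \<Longrightarrow>
     dist (\<gamma> a) (\<gamma> c) \<le> 2 * R \<Longrightarrow> dist (\<gamma> b) (\<gamma> c) \<le> 2 * R \<Longrightarrow> \<not> conn P 11 {z. R \<le> dist z (\<gamma> c)} (\<gamma> a) (\<gamma> b)"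
    using morse_no_detour[OF gs nav, of M lam kap 11] by blast
  define R where "R = Max {1, M0, lam + kap, R0}"
  have R: "1 \<le> R" "M0 \<le> R" "lam + kap \<le> R" "R0 \<le> R" by (auto simp: R_def)
  define E where "E = spread (2 * R) + (4 * R + l0 + k0 + 1)"
  have spR: "0 \<le> spread (2 * R)" using R by (intro spread_nonneg) auto
  have E: "spread (2 * R) + R \<le> E" "4 * R + l0 + k0 < E" using spR R l0 k0 by (auto simp: E_def)
  have spE: "0 \<le> spread E" using E spR R by (intro spread_nonneg) auto
  define r where "r = lam * (2 * R + spread E + 1 + kap)"
  have "1 * 1 \<le> lam * (2 * R + spread E + 1 + kap)" using lam R spE by (intro mult_mono) auto
  then have r: "1 \<le> r" by (simp add: r_def)
  \<comment> \<open>The improvedness bound for a piece of parameter length at most 1, whose ends are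
    at most \<open>lam + kap\<close> apart.\<close>
  define \<Lambda> where "\<Lambda> = lam * (lam + kap) * (lam + kap) + (lam * (2 * (lam + kap)) + 3) * (lam + kap)"
  have \<Lambda>: "0 \<le> \<Lambda>" using lam by (auto simp: \<Lambda>_def)
  define Z1 where "Z1 = r * (l0 * k0 + 1)"
  \<comment> \<open>\<open>Z\<close> serves as both entries of the global pair. It dominates the
    coefficients of the upper bound, of the lower bound with additive term \<open>Z1\<close>, and of
    the length estimate obtained by inserting that lower bound into
    \<open>curve_length_linear\<close>.\<close>
  define Z where "Z = 1 + (lam + kap) + r * l0 + Z1 + \<Lambda> * (r * l0) + \<Lambda> * (Z1 + 2)"
  have "0 \<le> r * l0" "0 \<le> Z1" using r l0 k0 by (auto simp: Z1_def)
  then have Z: "1 \<le> Z" "lam + kap \<le> Z" "r * l0 \<le> Z" "Z1 \<le> Z" "\<Lambda> * (r * l0) \<le> Z" "\<Lambda> * (Z1 + 2) \<le> Z"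
    using lam \<Lambda> by (auto simp: Z_def)
  let ?M' = "morse_bound R ((lam + kap) * (2 * r)) (lam + kap)"
  have morse_bound: "morse_gauge ?M'" using R lam r by (intro morse_gauge_morse_bound) auto
  have main: "morse_quasi_geodesic ?M' Z Z \<gamma> I"
    if I: "is_interval I" "continuous_on I \<gamma>" and loc: "locally_at_scale (2 * r) (morse_quasi_geodesic M lam kap) \<gamma> I"
    for \<gamma> :: "real \<Rightarrow> 'a" and I
  proof -
    have local: "morse_quasi_geodesic M lam kap \<gamma> {a..b}" if "{a..b} \<subseteq> I" "b - a \<le> 2 * r" for a b
    proof -
      have "\<forall>s\<in>{a..b}. \<forall>t\<in>{a..b}. \<bar>s - t\<bar> \<le> 2 * r" using that(2) by auto
      then show ?thesis using loc that(1) is_interval_cc[of a b] unfolding locally_at_scale_def by metis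
    qed
    have tame: "tame_path P l0 k0 \<gamma> s0 t0 lam kap M0 R E r" if sub: "{s0..t0} \<subseteq> I" for s0 t0
    proof unfold_locales
      show "continuous_on {s0..t0} \<gamma>" by (rule continuous_on_subset[OF I(2) sub])
      fix a b assume ab: "s0 \<le> a" "a \<le> b" "b \<le> t0" "b - a \<le> r"
      have mab: "morse_quasi_geodesic M lam kap \<gamma> {a..b}" using ab sub r by (intro local) auto
      then have qg: "1 / lam * \<bar>a - b\<bar> - kap \<le> dist (\<gamma> a) (\<gamma> b)" "dist (\<gamma> a) (\<gamma> b) \<le> lam * \<bar>a - b\<bar> + kap"
        using ab unfolding morse_quasi_geodesic_def quasi_geodesic_def by (meson atLeastAtMost_iff order_refl)+
      show "b - a \<le> lam * (dist (\<gamma> a) (\<gamma> b) + kap)" using qg(1) ab lam by (simp add: field_simps)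
      show "dist (\<gamma> a) (\<gamma> b) \<le> lam * (b - a) + kap" using qg(2) ab by simp
      show "link P {z. \<exists>e\<in>{a..b}. dist z (\<gamma> e) \<le> M0} (\<gamma> a) (\<gamma> b)"
      proof -
        obtain p where p: "p \<in> P" "seg_start p = \<gamma> a" "seg_end p = \<gamma> b" using ex_path by blast
        have comp: "compact (\<gamma> ` {a..b})" "\<gamma> ` {a..b} \<noteq> {}"
          using mab ab by (auto simp: morse_quasi_geodesic_def quasi_geodesic_def improved_def intro: compact_continuous_image)
        have near: "infdist (fn p u) (\<gamma> ` {a..b}) \<le> M0" if "u \<in> {lo p..hi p}" for u
          using mab quasi_geo[OF p(1)] lo_le_hi[OF p(1)] p ab that
          unfolding morse_quasi_geodesic_def morse_def M0_def seg_start_def seg_end_def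
          by (meson atLeastAtMost_iff order_refl)
        have "seg_image p \<subseteq> {z. \<exists>e\<in>{a..b}. dist z (\<gamma> e) \<le> M0}"
        proof
          fix z assume "z \<in> seg_image p"
          then have "infdist z (\<gamma> ` {a..b}) \<le> M0" using near by (auto simp: seg_image_def)
          then show "z \<in> {z. \<exists>e\<in>{a..b}. dist z (\<gamma> e) \<le> M0}"
            using infdist_compact_attained[OF comp, of z] by auto
        qed
        then show ?thesis using p by (auto simp: link_def)
      qed
    next
      fix a b c assume "s0 \<le> a" "a \<le> c" "c \<le> b" "b \<le> t0" "c - a \<le> r" "b - c \<le> r"
        "dist (\<gamma> a) (\<gamma> c) \<le> 2 * R" "dist (\<gamma> b) (\<gamma> c) \<le> 2 * R"
      then show "\<not> conn P 11 {z. R \<le> dist z (\<gamma> c)} (\<gamma> a) (\<gamma> b)"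
        using sub by (intro R0[OF R(4)] local) auto
    qed (use lam R E r_def in auto)
    have sub: "{s..t} \<subseteq> I" if "s \<in> I" "t \<in> I" for s t
      using I(1) that by (meson atLeastAtMost_iff is_interval_1 subsetI)
    have low: "t - s \<le> r * l0 * dist (\<gamma> s) (\<gamma> t) + Z1"
      and up: "dist (\<gamma> s) (\<gamma> t) \<le> Z * (t - s) + Z"
      and len: "curve_length \<gamma> s t \<le> ennreal (Z * dist (\<gamma> s) (\<gamma> t) + Z)"
      if st: "s \<in> I" "t \<in> I" "s \<le> t" for s t
    proof -
      interpret T: tame_path P l0 k0 \<gamma> s t lam kap M0 R E r by (rule tame[OF sub[OF st(1,2)]])
      show l: "t - s \<le> r * l0 * dist (\<gamma> s) (\<gamma> t) + Z1"
        using T.global_lower[of s t] st by (simp add: Z1_def algebra_simps)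
      have "(lam + kap) * (t - s) \<le> Z * (t - s)" using Z st by (intro mult_right_mono) auto
      then show "dist (\<gamma> s) (\<gamma> t) \<le> Z * (t - s) + Z" using T.global_upper[of s t] st Z by simp
      have "curve_length \<gamma> s t \<le> ennreal (\<Lambda> * (t - s) + 2 * \<Lambda>)"
      proof (rule curve_length_linear)
        fix a b assume ab: "s \<le> a" "a \<le> b" "b \<le> t" "b - a \<le> 1"
        have "{a..b} \<subseteq> I" using sub[OF st(1,2)] ab by force
        then have "improved lam kap \<gamma> {a..b}"
          using local[of a b] ab r by (auto simp: morse_quasi_geodesic_def quasi_geodesic_def)
        then have "curve_length \<gamma> a b \<le>
            ennreal (lam * (lam + kap) * dist (\<gamma> a) (\<gamma> b) + (lam * (2 * (lam + kap)) + 3) * (lam + kap))"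
          using ab by (simp add: improved_def)
        also have "\<dots> \<le> ennreal \<Lambda>"
        proof (rule ennreal_leI)
          have "lam * (b - a) \<le> lam * 1" using ab lam by (intro mult_left_mono) auto
          then have "dist (\<gamma> a) (\<gamma> b) \<le> lam + kap" using T.local_upper[of a b] ab r by simp
          then show "lam * (lam + kap) * dist (\<gamma> a) (\<gamma> b) + (lam * (2 * (lam + kap)) + 3) * (lam + kap) \<le> \<Lambda>"
            unfolding \<Lambda>_def using lam by (intro add_right_mono mult_left_mono) auto
        qed
        finally show "curve_length \<gamma> a b \<le> ennreal \<Lambda>" .
      qed (use \<Lambda> st in auto)
      also have "\<Lambda> * (t - s) + 2 * \<Lambda> \<le> \<Lambda> * (r * l0 * dist (\<gamma> s) (\<gamma> t) + Z1) + 2 * \<Lambda>"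
        using l \<Lambda> by (intro add_right_mono mult_left_mono) auto
      also have "\<dots> = \<Lambda> * (r * l0) * dist (\<gamma> s) (\<gamma> t) + \<Lambda> * (Z1 + 2)" by (simp add: algebra_simps)
      also have "\<dots> \<le> Z * dist (\<gamma> s) (\<gamma> t) + Z" using Z by (intro add_mono mult_right_mono) auto
      finally show "curve_length \<gamma> s t \<le> ennreal (Z * dist (\<gamma> s) (\<gamma> t) + Z)" by (simp add: ennreal_leI)
    qed
    have low': "1 / Z * (t - s) - Z \<le> dist (\<gamma> s) (\<gamma> t)" if st: "s \<in> I" "t \<in> I" "s \<le> t" for s t
    proof -
      have "r * l0 * dist (\<gamma> s) (\<gamma> t) \<le> Z * dist (\<gamma> s) (\<gamma> t)" using Z by (intro mult_right_mono) auto
      moreover have "1 * Z \<le> Z * Z" using Z by (intro mult_right_mono) auto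
      ultimately have "t - s \<le> Z * (dist (\<gamma> s) (\<gamma> t) + Z)"
        using low[OF st] Z unfolding distrib_left by linarith
      then show ?thesis using Z by (simp add: field_simps)
    qed
    have "1 / Z * \<bar>s - t\<bar> - Z \<le> dist (\<gamma> s) (\<gamma> t) \<and> dist (\<gamma> s) (\<gamma> t) \<le> Z * \<bar>s - t\<bar> + Z" if "s \<in> I" "t \<in> I" for s t
      using low'[of s t] low'[of t s] up[of s t] up[of t s] that
      by (cases "s \<le> t") (auto simp: dist_commute)
    moreover have "improved Z Z \<gamma> I"
      unfolding improved_def Let_def
    proof (intro conjI ballI impI I(2))
      fix s t assume "s \<in> I" "t \<in> I" "s \<le> t"
      then have "curve_length \<gamma> s t \<le> ennreal (Z * dist (\<gamma> s) (\<gamma> t) + Z)" by (rule len)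
      also have "\<dots> \<le> ennreal (Z * (Z + Z) * dist (\<gamma> s) (\<gamma> t) + (Z * (2 * (Z + Z)) + 3) * (Z + Z))"
      proof (intro ennreal_leI add_mono mult_right_mono)
        have "Z * 1 \<le> Z * (Z + Z)" using Z by (intro mult_left_mono) auto
        then show "Z \<le> Z * (Z + Z)" unfolding mult_1_right .
        have "1 * Z \<le> (Z * (2 * (Z + Z)) + 3) * (Z + Z)" using Z by (intro mult_mono) auto
        then show "Z \<le> (Z * (2 * (Z + Z)) + 3) * (Z + Z)" unfolding mult_1 .
      qed simp
      finally show "curve_length \<gamma> s t \<le> ennreal (Z * (Z + Z) * dist (\<gamma> s) (\<gamma> t) + (Z * (2 * (Z + Z)) + 3) * (Z + Z))" .
    qed
    ultimately have "quasi_geodesic Z Z \<gamma> I"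
      using I(1) Z by (auto simp: quasi_geodesic_def quasi_geodesic_pair_def)
    moreover have "morse ?M' \<gamma> I"
      unfolding morse_def
    proof (intro allI impI ballI, elim conjE)
      fix Q q s t \<sigma> c d u
      assume st: "s \<in> I" "t \<in> I" "s \<le> t" and \<sigma>: "c \<le> d" "quasi_geodesic Q q \<sigma> {c..d}" "\<sigma> c = \<gamma> s" "\<sigma> d = \<gamma> t"
        and u: "u \<in> {c..d}"
      interpret T: tame_path P l0 k0 \<gamma> s t lam kap M0 R E r by (rule tame[OF sub[OF st(1,2)]])
      show "infdist (\<sigma> u) (\<gamma> ` {s..t}) \<le> ?M' Q q" using \<sigma> u st(3) by (intro T.global_morse) auto
    qed
    ultimately show ?thesis by (simp add: morse_quasi_geodesic_def)
  qed
  show ?thesis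
  proof (intro exI conjI allI impI)
    \<comment> \<open>The scale is \<open>2 * r\<close> because \<open>local_no_detour\<close> looks
      up to \<open>r\<close> on both sides of a centre.\<close>
    show "0 < 2 * r" using r by simp
    show "quasi_geodesic_pair Z Z" using Z by (simp add: quasi_geodesic_pair_def)
    show "morse_gauge ?M'" by (rule morse_bound)
  qed (use main in blast)
qed

theorem corollary1p9:
  fixes P :: "'a::metric_space segment set"
  assumes "geodesic_space TYPE('a)"
    and "path_system P"
    and "navigable P"
    and "undirected P"
  shows "morse_local_to_global TYPE('a)"
proof -
  obtain l0 k0 where "path_family P l0 k0" using path_family_of assms by blast
  then show ?thesis
    unfolding morse_local_to_global_def using path_family.local_to_global assms by blast
qed

end
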